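(* The set of enumeration sequences $(|\mathcal{C}_n|)_{n\ge 0}$, where $\mathcal{C}$ ranges over all well-quasi-ordered permutation classes, is uncountable. That is, there are uncountably many well-quasi-ordered permutation classes with pairwise distinct enumeration sequences.
   Context: A permutation of length $n$ is an ordering of $\{1,\dots,n\}$ (one-line notation). A permutation $\pi$ contains a permutation $\sigma$ of length $k$ if $\pi$ has a subsequence of length $k$ with the same pairwise comparisons as $\sigma$. A permutation class is a set of permutations closed downward under containment. A permutation class is well-quasi-ordered if it contains no infinite antichain under containment. For a class $\mathcal{C}$, $\mathcal{C}_n$ denotes the set of its permutations of length $n$; the enumeration sequence of $\mathcal{C}$ is $(|\mathcal{C}_n|)_{n\ge0}$. *)

theory Defs
  imports
    "HOL-Library.Countable_Set"
    "HOL-Library.Sublist"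
    "HOL-Combinatorics.Multiset_Permutations"
begin

text \<open>
  A permutation of length \<open>n\<close> is a list in one-line notation, i.e. an element of
  \<open>permutations_of_set {1..n}\<close>.  The empty list is the permutation of length \<open>0\<close>.
\<close>

definition is_perm :: "nat list \<Rightarrow> bool" where
  "is_perm \<pi> \<longleftrightarrow> \<pi> \<in> permutations_of_set {1..length \<pi>}"

definition same_comparisons :: "nat list \<Rightarrow> nat list \<Rightarrow> bool" where
  "same_comparisons xs ys \<longleftrightarrow>
     length xs = length ys \<and>
     (\<forall>i<length xs. \<forall>j<length xs. xs ! i < xs ! j \<longleftrightarrow> ys ! i < ys ! j)"

text \<open>
  The library relation \<open>subseq\<close> allows gaps: entries of a subsequence need not be
  consecutive.
\<close>

definition contains_perm :: "nat list \<Rightarrow> nat list \<Rightarrow> bool" where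
  "contains_perm \<pi> \<sigma> \<longleftrightarrow> (\<exists>xs. subseq xs \<pi> \<and> same_comparisons xs \<sigma>)"

definition perm_class :: "nat list set \<Rightarrow> bool" where
  "perm_class C \<longleftrightarrow>
     (\<forall>\<pi>\<in>C. is_perm \<pi>) \<and>
     (\<forall>\<pi>\<in>C. \<forall>\<sigma>. is_perm \<sigma> \<longrightarrow> contains_perm \<pi> \<sigma> \<longrightarrow> \<sigma> \<in> C)"

text \<open>
  \<open>pairwise\<close> ranges over all ordered pairs of distinct elements, so both directions of
  containment are excluded.
\<close>

definition perm_antichain :: "nat list set \<Rightarrow> bool" where
  "perm_antichain A \<longleftrightarrow> pairwise (\<lambda>\<pi> \<sigma>. \<not> contains_perm \<pi> \<sigma>) A"

definition wqo_class :: "nat list set \<Rightarrow> bool" where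
  "wqo_class C \<longleftrightarrow> \<not> (\<exists>A. A \<subseteq> C \<and> infinite A \<and> perm_antichain A)"

definition enumeration_seq :: "nat list set \<Rightarrow> nat \<Rightarrow> nat" where
  "enumeration_seq C n = card {\<pi> \<in> C. length \<pi> = n}"

text \<open>The cardinalities in an enumeration sequence are genuine, not those of infinite sets:\<close>

lemma finite_perm_class_length:
  assumes "perm_class C"
  shows "finite {\<pi> \<in> C. length \<pi> = n}"
proof (rule finite_subset)
  show "{\<pi> \<in> C. length \<pi> = n} \<subseteq> permutations_of_set {1..n}"
    using assms by (auto simp: perm_class_def is_perm_def)
qed simp

end

theory Submission
  imports Defs "HOL-Library.Ramsey"
begin

text \<open>
  A binary word \<open>d\<close> steers a V-shaped pin sequence: for each letter, a pin going left or right
  (according to the letter) and cutting just below the previous point, then a pin going up and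
  cutting just inside that one.  How two points compare depends only on the later one and on
  whether they are consecutive, so a finite set of points is determined up to order isomorphism by
  the factors of \<open>d\<close> spelled by its maximal runs of consecutive indices.  If \<open>d\<close> is uniformly
  recurrent then its factors are well-quasi-ordered, and Higman's lemma yields that the class of all
  permutations drawn on the sequence is well-quasi-ordered.

  A family of uniformly recurrent words indexed by \<open>\<alpha> :: nat \<Rightarrow> bool\<close> is built from blocks
  \<open>A\<^sub>k\<close>, \<open>B\<^sub>k\<close> of equal length: all further blocks are concatenations of \<open>A\<^sub>k\<close> and \<open>B\<^sub>k\<close> if
  \<open>\<alpha> k\<close> holds, and of \<open>A\<^sub>kB\<^sub>k\<close> and \<open>B\<^sub>kA\<^sub>k\<close> otherwise.  If \<open>k\<close> is the first place where two
  sequences differ, then up to a suitable length the class of one contains that of the other,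
  properly: a long power of \<open>A\<^sub>k\<close> is a factor of only one of the two words, and long pin sequences
  embed into pin sequences only as factors, apart from a bounded initial part.  Hence the two
  enumeration sequences differ.
\<close>

subsection \<open>Higman's lemma\<close>

text \<open>Ramsey's theorem gives an infinite set of indices homogeneous for whether
  \<open>P\<close> holds; the negative colour is excluded because \<open>good\<close> applies to the
  subsequence itself.\<close>

lemma almost_full_homogeneous_subsequence:
  fixes P :: "'a \<Rightarrow> 'a \<Rightarrow> bool" and h :: "nat \<Rightarrow> 'a"
  assumes good: "\<And>f :: nat \<Rightarrow> 'a. \<exists>i j. i < j \<and> P (f i) (f j)"
  shows "\<exists>\<phi> :: nat \<Rightarrow> nat. strict_mono \<phi> \<and> (\<forall>i j. i < j \<longrightarrow> P (h (\<phi> i)) (h (\<phi> j)))"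
proof -
  define c where "c X = (if P (h (Min X)) (h (Max X)) then 1 else 0 :: nat)" for X
  have "\<exists>Y t. Y \<subseteq> UNIV \<and> infinite Y \<and> t < 2 \<and> (\<forall>x\<in>Y. \<forall>y\<in>Y. x \<noteq> y \<longrightarrow> c {x, y} = t)"
    by (rule Ramsey2) (auto simp: c_def)
  then obtain Y t where Y: "infinite Y" "\<forall>x\<in>Y. \<forall>y\<in>Y. x \<noteq> y \<longrightarrow> c {x, y} = t"
    by (elim exE conjE)
  define \<phi> where "\<phi> = enumerate Y"
  have mono: "strict_mono \<phi>" using Y(1) by (simp add: \<phi>_def strict_mono_enumerate)
  have c: "c {\<phi> i, \<phi> j} = t" if "i < j" for i j
    using Y(2) enumerate_in_set[OF Y(1)] strict_monoD[OF mono that]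
    by (metis \<phi>_def less_irrefl)
  have c': "c {\<phi> i, \<phi> j} = (if P (h (\<phi> i)) (h (\<phi> j)) then 1 else 0)" if "i < j" for i j
    using strict_monoD[OF mono that] by (simp add: c_def)
  obtain i j where "i < j" "P (h (\<phi> i)) (h (\<phi> j))" using good[of "h \<circ> \<phi>"] by auto
  then have "t = 1" using c c' by fastforce
  then have "P (h (\<phi> i)) (h (\<phi> j))" if "i < j" for i j
    using c[OF that] c'[OF that] by (metis zero_neq_one)
  with mono show ?thesis by blast
qed

text \<open>Nash-Williams's minimal bad sequence: each entry has least size among those that keep
  the prefix extendable to a bad sequence. By \<open>local\<close> the limit inherits badness from
  its prefixes.\<close>

lemma minimal_bad_sequence:
  fixes bad :: "(nat \<Rightarrow> 'a) \<Rightarrow> bool" and size :: "'a \<Rightarrow> nat"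
  assumes bad: "bad F0"
    and local: "\<And>F. (\<And>n. \<exists>G. bad G \<and> (\<forall>i<n. G i = F i)) \<Longrightarrow> bad F"
  obtains F where "bad F" "\<And>G n. bad G \<Longrightarrow> \<forall>i<n. G i = F i \<Longrightarrow> size (F n) \<le> size (G n)"
proof -
  define ext where "ext p \<longleftrightarrow> (\<exists>G. bad G \<and> (\<forall>i<length p. G i = p ! i))" for p
  define nxt where "nxt p = (ARG_MIN size x. ext (p @ [x]))" for p
  define pre where "pre n = rec_nat [] (\<lambda>_ p. p @ [nxt p]) n" for n
  define F where "F n = nxt (pre n)" for n
  have pre_simps [simp]: "pre 0 = []" "pre (Suc n) = pre n @ [F n]" for n
    by (simp_all add: pre_def F_def)
  have len [simp]: "length (pre n) = n" for n by (induction n) auto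
  have nth [simp]: "i < n \<Longrightarrow> pre n ! i = F i" for i n
    by (induction n) (auto simp: nth_append less_Suc_eq)
  have ext_pre: "ext (pre n)" for n
  proof (induction n)
    case 0 then show ?case using bad by (auto simp: ext_def)
  next
    case (Suc n)
    then obtain G where "bad G" "\<forall>i<n. G i = F i" by (auto simp: ext_def)
    then have "ext (pre n @ [G n])" unfolding ext_def
      by (intro exI[of _ G]) (auto simp: nth_append less_Suc_eq)
    then show ?case
      unfolding pre_simps F_def nxt_def by (rule arg_min_natI)
  qed
  show thesis
  proof
    have "\<exists>G. bad G \<and> (\<forall>i<n. G i = F i)" for n
      using ext_pre[of n] by (auto simp: ext_def)
    then show "bad F" by (rule local)
  next
    fix G n assume "bad G" "\<forall>i<n. G i = F i"
    then have "ext (pre n @ [G n])" unfolding ext_def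
      by (intro exI[of _ G]) (auto simp: nth_append less_Suc_eq)
    then show "size (F n) \<le> size (G n)"
      unfolding F_def nxt_def by (rule arg_min_nat_le)
  qed
qed

theorem higman:
  fixes P :: "'a \<Rightarrow> 'a \<Rightarrow> bool" and F :: "nat \<Rightarrow> 'a list"
  assumes good: "\<And>f :: nat \<Rightarrow> 'a. \<exists>i j. i < j \<and> P (f i) (f j)"
  shows "\<exists>i j. i < j \<and> list_emb P (F i) (F j)"
proof (rule ccontr)
  define bad where "bad F \<longleftrightarrow> (\<forall>i j. i < j \<longrightarrow> \<not> list_emb P (F i) (F j))" for F :: "nat \<Rightarrow> 'a list"
  assume "\<not> ?thesis"
  then have "bad F" by (auto simp: bad_def)
  then obtain M where M: "bad M"
    and min: "\<And>G n. bad G \<Longrightarrow> \<forall>i<n. G i = M i \<Longrightarrow> length (M n) \<le> length (G n)"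
  proof (rule minimal_bad_sequence[where size = length])
    fix F :: "nat \<Rightarrow> 'a list"
    assume F: "\<And>n. \<exists>G. bad G \<and> (\<forall>i<n. G i = F i)"
    show "bad F" unfolding bad_def
    proof (intro allI impI)
      fix i j :: nat assume "i < j"
      with F[of "Suc j"] show "\<not> list_emb P (F i) (F j)"
        unfolding bad_def by (metis less_Suc_eq)
    qed
  qed blast
  have ne: "M n \<noteq> []" for n
    using M unfolding bad_def by (metis lessI list_emb_Nil)
  define h t where "h n = hd (M n)" and "t n = tl (M n)" for n
  have M_eq: "M n = h n # t n" for n using ne by (simp add: h_def t_def)
  obtain \<phi> :: "nat \<Rightarrow> nat" where \<phi>: "strict_mono \<phi>" "\<And>i j. i < j \<Longrightarrow> P (h (\<phi> i)) (h (\<phi> j))"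
    using almost_full_homogeneous_subsequence[where P = P and h = h, OF good] by blast
  \<comment> \<open>An embedding between tails extends by the heads to entries of \<open>M\<close>,
    and one into a tail is one into the whole entry; so \<open>G\<close> is bad, yet shorter at
    \<open>\<phi> 0\<close>.\<close>
  define G where "G i = (if i < \<phi> 0 then M i else t (\<phi> (i - \<phi> 0)))" for i
  have "bad G" unfolding bad_def
  proof (intro allI impI)
    fix i j :: nat assume "i < j"
    show "\<not> list_emb P (G i) (G j)"
    proof
      assume emb: "list_emb P (G i) (G j)"
      consider "j < \<phi> 0" | "i < \<phi> 0" "\<phi> 0 \<le> j" | "\<phi> 0 \<le> i" using \<open>i < j\<close> by linarith
      then show False
      proof cases
        case 1
        with emb M \<open>i < j\<close> show ?thesis by (auto simp: G_def bad_def)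
      next
        case 2
        then have "list_emb P (M i) (M (\<phi> (j - \<phi> 0)))"
          using emb M_eq[of "\<phi> (j - \<phi> 0)"] by (auto simp: G_def)
        moreover have "i < \<phi> (j - \<phi> 0)"
          using 2 \<phi>(1) by (metis le0 less_le_trans strict_mono_less_eq)
        ultimately show ?thesis using M by (auto simp: bad_def)
      next
        case 3
        then have "i - \<phi> 0 < j - \<phi> 0" using \<open>i < j\<close> by simp
        then have "list_emb P (M (\<phi> (i - \<phi> 0))) (M (\<phi> (j - \<phi> 0)))" "\<phi> (i - \<phi> 0) < \<phi> (j - \<phi> 0)"
          using emb 3 \<open>i < j\<close> \<phi> M_eq by (auto simp: G_def strict_mono_less)
        then show ?thesis using M by (auto simp: bad_def)
      qed
    qed
  qed
  then have "length (M (\<phi> 0)) \<le> length (G (\<phi> 0))" by (rule min) (simp add: G_def)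
  then show False using M_eq[of "\<phi> 0"] by (simp add: G_def)
qed

section \<open>Containment as an increasing map of positions\<close>

lemma subseq_imp_index_map:
  assumes "subseq xs ys"
  shows "\<exists>\<phi>. (\<forall>i j. i < j \<and> j < length xs \<longrightarrow> \<phi> i < \<phi> j) \<and>
    (\<forall>i<length xs. \<phi> i < length ys \<and> ys ! \<phi> i = xs ! i)"
  using assms
proof (induction rule: list_emb.induct)
  case (list_emb_Nil ys)
  then show ?case by auto
next
  case (list_emb_Cons xs ys y)
  then obtain \<phi> where "\<forall>i j. i < j \<and> j < length xs \<longrightarrow> \<phi> i < \<phi> j"
    "\<forall>i<length xs. \<phi> i < length ys \<and> ys ! \<phi> i = xs ! i" by blast
  then show ?case by (intro exI[of _ "Suc \<circ> \<phi>"]) auto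
next
  case (list_emb_Cons2 x y xs ys)
  then obtain \<phi> where "\<forall>i j. i < j \<and> j < length xs \<longrightarrow> \<phi> i < \<phi> j"
    "\<forall>i<length xs. \<phi> i < length ys \<and> ys ! \<phi> i = xs ! i" by blast
  then show ?case using \<open>x = y\<close>
    by (intro exI[of _ "case_nat 0 (Suc \<circ> \<phi>)"]) (auto split: nat.splits simp: nth_Cons less_Suc_eq_0_disj)
qed

lemma contains_perm_iff_index_map:
  "contains_perm \<pi> \<sigma> \<longleftrightarrow> (\<exists>\<phi>. (\<forall>i j. i < j \<and> j < length \<sigma> \<longrightarrow> \<phi> i < \<phi> j) \<and>
     (\<forall>i<length \<sigma>. \<phi> i < length \<pi>) \<and>
     (\<forall>i<length \<sigma>. \<forall>j<length \<sigma>. \<pi> ! \<phi> i < \<pi> ! \<phi> j \<longleftrightarrow> \<sigma> ! i < \<sigma> ! j))"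
    (is "_ \<longleftrightarrow> (\<exists>\<phi>. ?index_map \<phi>)")
proof
  assume "contains_perm \<pi> \<sigma>"
  then obtain xs where xs: "subseq xs \<pi>" "same_comparisons xs \<sigma>" by (auto simp: contains_perm_def)
  obtain \<phi> where "\<forall>i j. i < j \<and> j < length xs \<longrightarrow> \<phi> i < \<phi> j"
    "\<forall>i<length xs. \<phi> i < length \<pi> \<and> \<pi> ! \<phi> i = xs ! i"
    using subseq_imp_index_map[OF xs(1)] by blast
  with xs(2) show "\<exists>\<phi>. ?index_map \<phi>"
    by (intro exI[of _ \<phi>]) (auto simp: same_comparisons_def)
next
  assume "\<exists>\<phi>. ?index_map \<phi>"
  then obtain \<phi> where \<phi>: "?index_map \<phi>" by blast
  have "sorted_wrt (<) (map \<phi> [0..<length \<sigma>])"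
    using \<phi> by (auto simp: sorted_wrt_map sorted_wrt_iff_nth_less)
  then have "subseq (map \<phi> [0..<length \<sigma>]) [0..<length \<pi>]"
    using \<phi> by (intro sorted_subset_imp_subseq) auto
  from subseq_map[OF this, of "(!) \<pi>"]
  have "subseq (map (\<lambda>i. \<pi> ! \<phi> i) [0..<length \<sigma>]) \<pi>"
    by (simp add: map_nth comp_def)
  then show "contains_perm \<pi> \<sigma>"
    unfolding contains_perm_def same_comparisons_def using \<phi>
    by (intro exI[of _ "map (\<lambda>i. \<pi> ! \<phi> i) [0..<length \<sigma>]"]) auto
qed

subsection \<open>Pin sequences\<close>

text \<open>
  Point \<open>2 * k\<close> is the sideways pin of letter \<open>k\<close> and point \<open>2 * k + 1\<close> its upward pin.  The absolute
  value of the abscissa exchanges points \<open>2 * k\<close> and \<open>2 * k + 1\<close>, the ordinate exchanges points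
  \<open>2 * k - 1\<close> and \<open>2 * k\<close>.
\<close>

definition pin_x :: "(nat \<Rightarrow> bool) \<Rightarrow> nat \<Rightarrow> int" where
  "pin_x d n = (if d (n div 2) then 1 else -1) * (if even n then int n + 2 else int n)"

definition pin_y :: "nat \<Rightarrow> int" where
  "pin_y n = (if even n then int n - 1 else int n + 1)"

text \<open>The point with larger absolute abscissa decides by its side. This is the later one,
  except when an upward pin follows its own sideways pin: both share a letter, and the upward pin is
  nearer the axis.\<close>

lemma pin_x_less_iff:
  assumes "a < b"
  shows "pin_x d a < pin_x d b \<longleftrightarrow> (d (b div 2) \<longleftrightarrow> \<not> (b = Suc a \<and> odd b))"
proof (cases "b = Suc a \<and> odd b")
  case True
  then show ?thesis by (auto simp: pin_x_def)
next
  case False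
  with assms have "(if even a then int a + 2 else int a) < (if even b then int b + 2 else int b)"
  proof -
    consider "b = Suc a" | "b = Suc (Suc a)" | "Suc (Suc a) < b" using assms by linarith
    then show ?thesis using False by cases auto
  qed
  with False show ?thesis by (auto simp: pin_x_def split: if_splits)
qed

lemma pin_y_less_iff:
  assumes "a < b"
  shows "pin_y a < pin_y b \<longleftrightarrow> \<not> (b = Suc a \<and> even b)"
proof (cases "b = Suc a \<and> even b")
  case False
  with assms show ?thesis
    by (cases "b = Suc a"; cases "b = Suc (Suc a)") (auto simp: pin_y_def)
qed (auto simp: pin_y_def)

lemma pin_x_eq_iff [simp]: "pin_x d a = pin_x d b \<longleftrightarrow> a = b"
proof -
  have "pin_x d a \<noteq> pin_x d b" if "a < b" for a b
  proof
    assume eq: "pin_x d a = pin_x d b"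
    then have "\<bar>pin_x d a\<bar> = \<bar>pin_x d b\<bar>" by simp
    then have mag: "(if even a then int a + 2 else int a) = (if even b then int b + 2 else int b)"
      by (auto simp: pin_x_def abs_mult split: if_splits)
    then have "even a \<longleftrightarrow> even b" by (auto split: if_splits) presburger+
    with mag that show False by (auto split: if_splits)
  qed
  then show ?thesis by (metis linorder_neqE_nat)
qed

lemma pin_y_eq_iff [simp]: "pin_y a = pin_y b \<longleftrightarrow> a = b"
  by (auto simp: pin_y_def split: if_splits) presburger+

text \<open>The entry of \<open>\<sigma>\<close> at position \<open>i\<close> is plotted at the point with index \<open>g i\<close>.\<close>

definition draws :: "(nat \<Rightarrow> bool) \<Rightarrow> nat list \<Rightarrow> (nat \<Rightarrow> nat) \<Rightarrow> bool" where
  "draws d \<sigma> g \<longleftrightarrow>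
     (\<forall>i j. i < j \<and> j < length \<sigma> \<longrightarrow> pin_x d (g i) < pin_x d (g j)) \<and>
     (\<forall>i<length \<sigma>. \<forall>j<length \<sigma>. \<sigma> ! i < \<sigma> ! j \<longleftrightarrow> pin_y (g i) < pin_y (g j))"

definition pin_class :: "(nat \<Rightarrow> bool) \<Rightarrow> nat list set" where
  "pin_class d = {\<sigma>. is_perm \<sigma> \<and> (\<exists>g. draws d \<sigma> g)}"

lemma draws_x_less_iff:
  assumes "draws d \<sigma> g" "i < length \<sigma>" "j < length \<sigma>"
  shows "pin_x d (g i) < pin_x d (g j) \<longleftrightarrow> i < j"
  using assms unfolding draws_def by (metis less_asym linorder_neqE_nat)

lemma draws_sub:
  assumes g: "draws d \<pi> g"
    and "\<forall>i j. i < j \<and> j < length \<sigma> \<longrightarrow> \<phi> i < \<phi> j" "\<forall>i<length \<sigma>. \<phi> i < length \<pi>"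
      "\<forall>i<length \<sigma>. \<forall>j<length \<sigma>. \<pi> ! \<phi> i < \<pi> ! \<phi> j \<longleftrightarrow> \<sigma> ! i < \<sigma> ! j"
  shows "draws d \<sigma> (g \<circ> \<phi>)"
  using assms unfolding draws_def by simp

lemma perm_class_pin_class: "perm_class (pin_class d)"
  unfolding perm_class_def pin_class_def
  using draws_sub by (auto simp: contains_perm_iff_index_map) metis

text \<open>Parity, letter and adjacency are all that \<open>pin_x_less_iff\<close> and
  \<open>pin_y_less_iff\<close> read off two indices, so such a map preserves both orders. Two words
  are allowed in order to transfer drawings between classes.\<close>

definition pin_embedding ::
    "(nat \<Rightarrow> bool) \<Rightarrow> (nat \<Rightarrow> bool) \<Rightarrow> nat set \<Rightarrow> nat set \<Rightarrow> (nat \<Rightarrow> nat) \<Rightarrow> bool" where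
  "pin_embedding d e S T f \<longleftrightarrow> f ` S \<subseteq> T \<and>
     (\<forall>a\<in>S. (even (f a) \<longleftrightarrow> even a) \<and> e (f a div 2) = d (a div 2)) \<and>
     (\<forall>a\<in>S. \<forall>b\<in>S. a < b \<longrightarrow> f a < f b \<and> (f b = Suc (f a) \<longleftrightarrow> b = Suc a))"

lemma pin_embedding_less_iff:
  assumes f: "pin_embedding d e S T f" and "a \<in> S" "b \<in> S"
  shows "pin_x e (f a) < pin_x e (f b) \<longleftrightarrow> pin_x d a < pin_x d b"
    and "pin_y (f a) < pin_y (f b) \<longleftrightarrow> pin_y a < pin_y b"
proof -
  have less: "(pin_x e (f a) < pin_x e (f b) \<longleftrightarrow> pin_x d a < pin_x d b) \<and>
    (pin_y (f a) < pin_y (f b) \<longleftrightarrow> pin_y a < pin_y b)" if "a < b" "a \<in> S" "b \<in> S" for a b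
  proof -
    have "f a < f b" "f b = Suc (f a) \<longleftrightarrow> b = Suc a" "even (f b) \<longleftrightarrow> even b" "e (f b div 2) = d (b div 2)"
      using f that by (auto simp: pin_embedding_def)
    with \<open>a < b\<close> show ?thesis by (simp add: pin_x_less_iff pin_y_less_iff)
  qed
  have neq: "f a \<noteq> f b" if "a \<noteq> b" "a \<in> S" "b \<in> S" for a b
    using f that unfolding pin_embedding_def by (metis less_irrefl linorder_neqE_nat)
  consider "a < b" | "a = b" | "b < a" by linarith
  then have "(pin_x e (f a) < pin_x e (f b) \<longleftrightarrow> pin_x d a < pin_x d b) \<and>
    (pin_y (f a) < pin_y (f b) \<longleftrightarrow> pin_y a < pin_y b)"
  proof cases
    case 3
    have "pin_x e (f a) \<noteq> pin_x e (f b)" "pin_x d a \<noteq> pin_x d b" "pin_y (f a) \<noteq> pin_y (f b)" "pin_y a \<noteq> pin_y b"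
      using neq[of a b] assms(2,3) 3 by auto
    with less[of b a] 3 assms(2,3) show ?thesis by (meson less_asym linorder_neqE)
  qed (use less assms(2,3) in auto)
  then show "pin_x e (f a) < pin_x e (f b) \<longleftrightarrow> pin_x d a < pin_x d b"
    and "pin_y (f a) < pin_y (f b) \<longleftrightarrow> pin_y a < pin_y b" by auto
qed

lemma draws_pin_embedding:
  assumes g: "draws d \<sigma> g" and f: "pin_embedding d e (g ` {..<length \<sigma>}) T f"
  shows "draws e \<sigma> (f \<circ> g)"
proof -
  have "pin_x e (f (g i)) < pin_x e (f (g j)) \<longleftrightarrow> pin_x d (g i) < pin_x d (g j)"
    "pin_y (f (g i)) < pin_y (f (g j)) \<longleftrightarrow> pin_y (g i) < pin_y (g j)"
    if "i < length \<sigma>" "j < length \<sigma>" for i j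
    using pin_embedding_less_iff[OF f, of "g i" "g j"] that by auto
  with g show ?thesis by (auto simp: draws_def)
qed

lemma contains_perm_pin_embedding:
  assumes g: "draws d \<sigma> g" and h: "draws d \<pi> h"
    and f: "pin_embedding d d (g ` {..<length \<sigma>}) (h ` {..<length \<pi>}) f"
  shows "contains_perm \<pi> \<sigma>"
proof -
  define \<phi> where "\<phi> i = (SOME m. m < length \<pi> \<and> h m = f (g i))" for i
  have \<phi>: "\<phi> i < length \<pi> \<and> h (\<phi> i) = f (g i)" if "i < length \<sigma>" for i
  proof -
    have "f (g i) \<in> h ` {..<length \<pi>}" using f that by (auto simp: pin_embedding_def)
    then have "\<exists>m. m < length \<pi> \<and> h m = f (g i)" by auto
    then show ?thesis unfolding \<phi>_def by (rule someI_ex)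
  qed
  have fg: "draws d \<sigma> (f \<circ> g)" by (rule draws_pin_embedding[OF g f])
  have "\<phi> i < \<phi> j" if "i < j" "j < length \<sigma>" for i j
  proof -
    have "pin_x d (h (\<phi> i)) < pin_x d (h (\<phi> j))"
      using fg \<phi>[of i] \<phi>[of j] that by (auto simp: draws_def)
    moreover have "\<phi> i < length \<pi>" "\<phi> j < length \<pi>" using \<phi> that by auto
    ultimately show ?thesis using draws_x_less_iff[OF h] by blast
  qed
  moreover have "\<pi> ! \<phi> i < \<pi> ! \<phi> j \<longleftrightarrow> \<sigma> ! i < \<sigma> ! j" if "i < length \<sigma>" "j < length \<sigma>" for i j
    using fg h \<phi>[OF that(1)] \<phi>[OF that(2)] that by (auto simp: draws_def)
  ultimately show ?thesis
    unfolding contains_perm_iff_index_map using \<phi> by (intro exI[of _ \<phi>]) blast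
qed

text \<open>Standardization of a point set: abscissas fix the positions, ranks of the ordinates the
  entries.\<close>

lemma exists_drawing:
  assumes "finite S"
  shows "\<exists>\<sigma> g. is_perm \<sigma> \<and> draws d \<sigma> g \<and> bij_betw g {..<length \<sigma>} S \<and> length \<sigma> = card S"
proof -
  define xs where "xs = sorted_list_of_set (pin_x d ` S)"
  have inj: "inj_on (pin_x d) S" by (auto simp: inj_on_def)
  have xs: "sorted_wrt (<) xs" "set xs = pin_x d ` S" "length xs = card S" "distinct xs"
    using assms inj by (auto simp: xs_def card_image)
  define g where "g i = the_inv_into S (pin_x d) (xs ! i)" for i
  have g_in: "g i \<in> S" and x_g: "pin_x d (g i) = xs ! i" if "i < card S" for i
  proof -
    have "xs ! i \<in> pin_x d ` S" using that xs by (metis nth_mem)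
    then show "g i \<in> S" "pin_x d (g i) = xs ! i" unfolding g_def
      using inj by (auto intro: the_inv_into_into f_the_inv_into_f)
  qed
  have "inj_on g {..<card S}"
    using x_g xs by (intro inj_onI) (metis lessThan_iff nth_eq_iff_index_eq)
  then have bij: "bij_betw g {..<card S} S"
    unfolding bij_betw_def using g_in assms
    by (intro conjI card_subset_eq) (auto simp: card_image)
  define rank where "rank p = card {q \<in> S. pin_y q \<le> pin_y p}" for p
  have rank_less: "rank p < rank q \<longleftrightarrow> pin_y p < pin_y q" if "p \<in> S" "q \<in> S" for p q
  proof -
    have mono: "rank p < rank q" if "p \<in> S" "q \<in> S" "pin_y p < pin_y q" for p q
      unfolding rank_def using that assms by (intro psubset_card_mono) (auto, force)
    consider "pin_y p < pin_y q" | "p = q" | "pin_y q < pin_y p"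
      using pin_y_eq_iff by (metis linorder_less_linear)
    then show ?thesis using mono[of p q] mono[of q p] that by cases auto
  qed
  define \<sigma> where "\<sigma> = map (\<lambda>i. rank (g i)) [0..<card S]"
  have inj_rank: "inj_on rank S"
    using rank_less by (intro inj_onI) (metis less_irrefl linorder_neqE pin_y_eq_iff)
  have "rank ` S \<subseteq> {1..card S}"
  proof
    fix r assume "r \<in> rank ` S"
    then obtain p where p: "p \<in> S" "r = rank p" by blast
    have "0 < rank p" unfolding rank_def using p assms by (auto simp: card_gt_0_iff)
    moreover have "rank p \<le> card S" unfolding rank_def using assms by (intro card_mono) auto
    ultimately show "r \<in> {1..card S}" using p by simp
  qed
  then have rank_image: "rank ` S = {1..card S}"
    using assms inj_rank by (intro card_subset_eq) (auto simp: card_image)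
  have "set \<sigma> = rank ` (g ` {..<card S})" by (auto simp: \<sigma>_def)
  also have "\<dots> = {1..card S}" using bij rank_image by (simp add: bij_betw_def)
  finally have "set \<sigma> = {1..length \<sigma>}" by (simp add: \<sigma>_def)
  moreover from this have "distinct \<sigma>" by (simp add: card_distinct)
  ultimately have "is_perm \<sigma>" by (simp add: is_perm_def permutations_of_set_def)
  moreover have "draws d \<sigma> g"
    using x_g g_in rank_less xs by (auto simp: draws_def \<sigma>_def sorted_wrt_iff_nth_less)
  ultimately show ?thesis using bij by (intro exI[of _ \<sigma>] exI[of _ g]) (simp add: \<sigma>_def)
qed

subsection \<open>Well-quasi-order\<close>

definition spans :: "(nat \<times> nat) list \<Rightarrow> nat set" where
  "spans ivs = (\<Union>(s, l)\<in>set ivs. {s..<s + l})"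

lemma spans_simps [simp]: "spans [] = {}" "spans ((s, l) # ivs) = {s..<s + l} \<union> spans ivs"
  by (auto simp: spans_def)

text \<open>Strictness keeps consecutive indices from lying in different intervals.\<close>

fun gapped :: "(nat \<times> nat) list \<Rightarrow> bool" where
  "gapped [] \<longleftrightarrow> True"
| "gapped ((s, l) # ivs) \<longleftrightarrow> gapped ivs \<and> (\<forall>b\<in>spans ivs. s + l < b)"

definition same_letters :: "(nat \<Rightarrow> bool) \<Rightarrow> (nat \<Rightarrow> bool) \<Rightarrow> nat \<Rightarrow> nat \<Rightarrow> nat \<Rightarrow> bool" where
  "same_letters d e l s t \<longleftrightarrow>
     (\<forall>i<l. (even (t + i) \<longleftrightarrow> even (s + i)) \<and> e ((t + i) div 2) = d ((s + i) div 2))"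

definition interval_emb ::
    "(nat \<Rightarrow> bool) \<Rightarrow> (nat \<Rightarrow> bool) \<Rightarrow> nat \<times> nat \<Rightarrow> nat \<times> nat \<Rightarrow> bool" where
  "interval_emb d e = (\<lambda>(s, l) (s', l'). \<exists>k. k + l \<le> l' \<and> same_letters d e l s (s' + k))"

text \<open>Peel off the maximal run starting at the minimum; the rest lies beyond the first missing
  index, which provides the gap.\<close>

lemma finite_eq_spans:
  "finite S \<Longrightarrow> \<exists>ivs. gapped ivs \<and> spans ivs = S"
proof (induction "card S" arbitrary: S rule: less_induct)
  case less
  show ?case
  proof (cases "S = {}")
    case True
    then show ?thesis by (intro exI[of _ "[]"]) simp
  next
    case False
    define a where "a = Min S"
    have a: "a \<in> S" "\<And>x. x \<in> S \<Longrightarrow> a \<le> x" using less.prems False by (auto simp: a_def)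
    define l where "l = (LEAST l. a + l \<notin> S)"
    have "\<exists>l. a + l \<notin> S"
      using less.prems by (intro exI[of _ "Suc (Max S)"]) (auto dest: Max_ge)
    then have l: "a + l \<notin> S" unfolding l_def by (rule LeastI_ex)
    have l': "a + i \<in> S" if "i < l" for i using not_less_Least that unfolding l_def by blast
    define R where "R = {x \<in> S. a + l < x}"
    have "x \<in> {a..<a + l} \<union> R" if "x \<in> S" for x
      using a(2)[OF that] l that by (cases "x = a + l") (auto simp: R_def)
    moreover have "x \<in> S" if "x \<in> {a..<a + l} \<union> R" for x
      using l'[of "x - a"] that by (auto simp: R_def)
    ultimately have S: "S = {a..<a + l} \<union> R" by blast
    have "R \<subset> S" using a(1) by (auto simp: R_def)
    then have "card R < card S" "finite R"
      using less.prems by (auto intro: psubset_card_mono finite_subset)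
    then obtain ivs where ivs: "gapped ivs" "spans ivs = R" using less.hyps by blast
    moreover have "\<forall>b\<in>R. a + l < b" by (simp add: R_def)
    ultimately have "gapped ((a, l) # ivs) \<and> spans ((a, l) # ivs) = S" unfolding S by simp
    then show ?thesis by blast
  qed
qed

text \<open>Each interval is translated into its partner. Gaps in source and target make points of
  different intervals nonadjacent in both, so adjacency matters only within an interval.\<close>

lemma pin_embedding_of_list_emb:
  assumes "list_emb (interval_emb d e) ivs jvs" "gapped ivs" "gapped jvs"
  shows "\<exists>f. pin_embedding d e (spans ivs) (spans jvs) f"
  using assms
proof (induction rule: list_emb.induct)
  case (list_emb_Nil jvs)
  then show ?case by (simp add: pin_embedding_def)
next
  case (list_emb_Cons ivs jvs J)
  obtain s' l' where J: "J = (s', l')" by fastforce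
  from list_emb_Cons obtain f where "pin_embedding d e (spans ivs) (spans jvs) f" by (auto simp: J)
  then show ?case by (intro exI[of _ f]) (auto simp: pin_embedding_def J)
next
  case (list_emb_Cons2 I J ivs jvs)
  obtain s l s' l' where IJ: "I = (s, l)" "J = (s', l')" by fastforce
  from list_emb_Cons2 obtain f where f: "pin_embedding d e (spans ivs) (spans jvs) f" by (auto simp: IJ)
  from list_emb_Cons2(1) obtain k where k: "k + l \<le> l'" "same_letters d e l s (s' + k)"
    by (auto simp: interval_emb_def IJ)
  have gap: "s + l < a" if "a \<in> spans ivs" for a using list_emb_Cons2 that by (auto simp: IJ)
  have gap': "s' + l' < b" if "b \<in> spans jvs" for b using list_emb_Cons2 that by (auto simp: IJ)
  define g where "g a = (if a < s + l then s' + k + (a - s) else f a)" for a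
  have g1: "g (s + i) = s' + k + i" if "i < l" for i using that by (simp add: g_def)
  have g2: "g a = f a" "f a \<in> spans jvs" "s' + l' < f a" "s + l < a" if "a \<in> spans ivs" for a
    using gap[OF that] gap' f that by (auto simp: g_def pin_embedding_def)
  have "pin_embedding d e ({s..<s + l} \<union> spans ivs) ({s'..<s' + l'} \<union> spans jvs) g"
    unfolding pin_embedding_def
  proof (intro conjI ballI impI)
    show "g ` ({s..<s + l} \<union> spans ivs) \<subseteq> {s'..<s' + l'} \<union> spans jvs"
    proof
      fix x assume "x \<in> g ` ({s..<s + l} \<union> spans ivs)"
      then consider i where "i < l" "x = g (s + i)" | a where "a \<in> spans ivs" "x = g a"
        by (auto dest!: le_Suc_ex)
      then show "x \<in> {s'..<s' + l'} \<union> spans jvs" using k(1) g1 g2 by cases auto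
    qed
  next
    fix a assume a: "a \<in> {s..<s + l} \<union> spans ivs"
    have "even (g a) = even a \<and> e (g a div 2) = d (a div 2)"
    proof (cases "a < s + l")
      case True
      with a gap[of a] have "s \<le> a" by auto
      with True obtain i where "i < l" "a = s + i" by (auto dest!: le_Suc_ex)
      then show ?thesis using k(2) g1 by (simp add: same_letters_def)
    next
      case False
      then show ?thesis using a g2 f by (auto simp: pin_embedding_def)
    qed
    then show "even (g a) = even a" "e (g a div 2) = d (a div 2)" by auto
    fix b assume b: "b \<in> {s..<s + l} \<union> spans ivs" and "a < b"
    have "g a < g b \<and> (g b = Suc (g a) \<longleftrightarrow> b = Suc a)"
    proof (cases "b \<in> spans ivs")
      case bT: True
      show ?thesis
      proof (cases "a \<in> spans ivs")
        case True
        then show ?thesis using bT \<open>a < b\<close> f g2 by (auto simp: pin_embedding_def)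
      next
        case False
        with a obtain i where i: "i < l" "a = s + i" by (auto dest!: le_Suc_ex)
        then show ?thesis using g1[OF i(1)] g2[OF bT] k(1) by auto
      qed
    next
      case False
      with b obtain j where j: "j < l" "b = s + j" by (auto dest!: le_Suc_ex)
      with a gap[of a] \<open>a < b\<close> have "s \<le> a" by auto
      with j \<open>a < b\<close> obtain i where ij: "i < j" "j < l" "a = s + i" "b = s + j"
        by (auto dest!: le_Suc_ex)
      then show ?thesis using g1[of i] g1[of j] by auto
    qed
    then show "g a < g b" "g b = Suc (g a) \<longleftrightarrow> b = Suc a" by auto
  qed
  then show ?case by (auto simp: IJ)
qed

section \<open>Uniform recurrence and its consequences for pin classes\<close>

definition uniformly_recurrent :: "(nat \<Rightarrow> bool) \<Rightarrow> bool" where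
  "uniformly_recurrent d \<longleftrightarrow>
     (\<forall>L. \<exists>R. \<forall>s e. \<exists>t\<ge>e. t + L \<le> e + R \<and> (\<forall>i<L. d (t + i) = d (s + i)))"

text \<open>Whatever the parity of \<open>s\<close>, a run of \<open>l\<close> points meets at most
  \<open>Suc (l div 2)\<close> letters; the summand \<open>s mod 2\<close> keeps the kinds of the
  pins.\<close>

lemma same_lettersI:
  assumes "\<forall>i<Suc (l div 2). e (t + i) = d (s div 2 + i)"
  shows "same_letters d e l s (2 * t + s mod 2)"
  unfolding same_letters_def
proof (intro allI impI)
  fix i assume "i < l"
  define r where "r = (s mod 2 + i) div 2"
  have r: "r < Suc (l div 2)" using \<open>i < l\<close> by (auto simp: r_def)
  have "(2 * t + s mod 2 + i) div 2 = t + r" "(s + i) div 2 = s div 2 + r"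
    unfolding r_def by presburger+
  moreover have "even (2 * t + s mod 2 + i) \<longleftrightarrow> even (s + i)" by presburger
  ultimately show "even (2 * t + s mod 2 + i) = even (s + i) \<and>
      e ((2 * t + s mod 2 + i) div 2) = d ((s + i) div 2)"
    using assms r by simp
qed

text \<open>Either some later interval is long enough to contain the first run, by uniform
  recurrence, or all later lengths are bounded and two of the finitely many possible spelled runs
  coincide.\<close>

lemma interval_emb_good:
  fixes F :: "nat \<Rightarrow> nat \<times> nat"
  assumes d: "uniformly_recurrent d"
  shows "\<exists>i j. i < j \<and> interval_emb d d (F i) (F j)"
proof -
  obtain s l where F0: "F 0 = (s, l)" by fastforce
  obtain R where R: "\<And>s e. \<exists>t\<ge>e. t + Suc (l div 2) \<le> e + R \<and> (\<forall>i<Suc (l div 2). d (t + i) = d (s + i))"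
    using d unfolding uniformly_recurrent_def by blast
  show ?thesis
  \<comment> \<open>A window of \<open>R\<close> letters takes \<open>2 * R\<close> points; the
    other 5 cover the move from \<open>s'\<close> to the next letter and the parity of
    \<open>s\<close>.\<close>
  proof (cases "\<exists>j>0. 2 * R + 5 \<le> snd (F j)")
    case True
    then obtain j s' l' where j: "0 < j" "F j = (s', l')" "2 * R + 5 \<le> l'" by (metis prod.collapse)
    obtain t where t: "Suc (s' div 2) \<le> t" "t + Suc (l div 2) \<le> Suc (s' div 2) + R"
      "\<forall>i<Suc (l div 2). d (t + i) = d (s div 2 + i)" using R by blast
    define k where "k = 2 * t + s mod 2 - s'"
    have half: "s' < 2 * Suc (s' div 2)" "2 * (s' div 2) \<le> s'" "l < 2 * Suc (l div 2)" "s mod 2 < 2"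
      by simp_all
    have "s' + k = 2 * t + s mod 2" using t(1) half unfolding k_def by linarith
    moreover from this have "k + l \<le> l'" using t(2) j(3) half by linarith
    ultimately show ?thesis using same_lettersI[OF t(3)] j F0
      by (intro exI[of _ 0] exI[of _ j]) (auto simp: interval_emb_def)
  next
    case False
    define h where "h j = (let (s, l) = F (Suc j) in map (\<lambda>i. (even (s + i), d ((s + i) div 2))) [0..<l])" for j
    have "range h \<subseteq> {xs. set xs \<subseteq> UNIV \<and> length xs \<le> 2 * R + 5}"
    proof
      fix x assume "x \<in> range h"
      then obtain j where "x = h j" by blast
      then show "x \<in> {xs. set xs \<subseteq> UNIV \<and> length xs \<le> 2 * R + 5}"
        using False[simplified, rule_format, of "Suc j"] by (simp add: h_def split: prod.splits)
    qed
    then have "finite (range h)" by (rule finite_subset) (rule finite_lists_length_le, simp)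
    then have "\<not> inj h" using finite_imageD infinite_UNIV_nat by blast
    then obtain i j where ij: "i < j" "h i = h j" unfolding inj_def by (metis linorder_neqE_nat)
    obtain s l s' l' where F: "F (Suc i) = (s, l)" "F (Suc j) = (s', l')" by fastforce
    have eq: "map (\<lambda>i. (even (s + i), d ((s + i) div 2))) [0..<l] =
          map (\<lambda>i. (even (s' + i), d ((s' + i) div 2))) [0..<l']"
      using ij(2) by (simp add: h_def F)
    from arg_cong[OF eq, of length] have "l = l'" by simp
    with eq have "same_letters d d l s s'" by (auto simp: same_letters_def)
    then have "interval_emb d d (F (Suc i)) (F (Suc j))"
      using \<open>l = l'\<close> by (auto simp: interval_emb_def F intro!: exI[of _ 0])
    with ij(1) show ?thesis by blast
  qed
qed

theorem wqo_pin_class: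
  assumes d: "uniformly_recurrent d"
  shows "wqo_class (pin_class d)"
  unfolding wqo_class_def
proof
  assume "\<exists>A. A \<subseteq> pin_class d \<and> infinite A \<and> perm_antichain A"
  then obtain A where A: "A \<subseteq> pin_class d" "infinite A" "perm_antichain A" by blast
  obtain \<sigma> :: "nat \<Rightarrow> nat list" where \<sigma>: "inj \<sigma>" "range \<sigma> \<subseteq> A"
    using infinite_countable_subset[OF A(2)] by (elim exE conjE)
  have "\<sigma> n \<in> pin_class d" for n using A(1) \<sigma>(2) by blast
  then have "\<exists>g. draws d (\<sigma> n) g" for n by (simp add: pin_class_def)
  then obtain g where g: "\<And>n. draws d (\<sigma> n) (g n)" by metis
  have "\<exists>ivs. gapped ivs \<and> spans ivs = g n ` {..<length (\<sigma> n)}" for n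
    by (rule finite_eq_spans) simp
  then obtain iv where iv: "\<And>n. gapped (iv n)" "\<And>n. spans (iv n) = g n ` {..<length (\<sigma> n)}" by metis
  obtain i j where ij: "i < j" "list_emb (interval_emb d d) (iv i) (iv j)"
    using higman[where P = "interval_emb d d", OF interval_emb_good[OF d]] by blast
  then obtain f where "pin_embedding d d (spans (iv i)) (spans (iv j)) f"
    using pin_embedding_of_list_emb iv(1) by blast
  then have "contains_perm (\<sigma> j) (\<sigma> i)" using contains_perm_pin_embedding[OF g g] iv(2) by simp
  moreover have "\<sigma> j \<noteq> \<sigma> i" using \<sigma>(1) ij(1) by (metis injD less_irrefl)
  moreover have "\<sigma> i \<in> A" "\<sigma> j \<in> A" using \<sigma>(2) by blast+
  ultimately show False using A(3) by (auto simp: perm_antichain_def pairwise_def)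
qed

text \<open>Each interval of the drawing has at most \<open>N\<close> points, hence at most
  \<open>Suc (N div 2)\<close> letters, and \<open>occ\<close> finds these arbitrarily far out in
  \<open>e\<close>; so the intervals can be placed one after another.\<close>

lemma pin_class_mono_upto:
  assumes occ: "\<And>s b. \<exists>t\<ge>b. \<forall>i<Suc (N div 2). e (t + i) = d (s + i)"
    and \<sigma>: "\<sigma> \<in> pin_class d" "length \<sigma> \<le> N"
  shows "\<sigma> \<in> pin_class e"
proof -
  obtain g where g: "draws d \<sigma> g" and perm: "is_perm \<sigma>" using \<sigma>(1) by (auto simp: pin_class_def)
  obtain ivs where ivs: "gapped ivs" "spans ivs = g ` {..<length \<sigma>}"
    using finite_eq_spans[of "g ` {..<length \<sigma>}"] by auto
  have "card (spans ivs) \<le> N"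
    using \<sigma>(2) ivs(2) card_image_le[of "{..<length \<sigma>}" g] by simp
  then have "\<forall>(s, l)\<in>set ivs. l \<le> N"
  proof -
    have "l \<le> card (spans ivs)" if "(s, l) \<in> set ivs" for s l
    proof -
      have "{s..<s + l} \<subseteq> spans ivs" using that by (auto simp: spans_def)
      then have "card {s..<s + l} \<le> card (spans ivs)" using ivs(2) by (intro card_mono) auto
      then show ?thesis by simp
    qed
    then show ?thesis using \<open>card (spans ivs) \<le> N\<close> by fastforce
  qed
  then have "\<exists>jvs. gapped jvs \<and> (\<forall>x\<in>spans jvs. b \<le> x) \<and> list_emb (interval_emb d e) ivs jvs" for b
  proof (induction ivs arbitrary: b)
    case Nil
    then show ?case by (intro exI[of _ "[]"]) simp
  next
    case (Cons I ivs)
    obtain s l where I: "I = (s, l)" by fastforce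
    obtain t where t: "b \<le> t" "\<forall>i<Suc (N div 2). e (t + i) = d (s div 2 + i)" using occ by blast
    have "l div 2 \<le> N div 2" using Cons.prems by (intro div_le_mono) (simp add: I)
    then have same: "same_letters d e l s (2 * t + s mod 2)"
      using t(2) by (intro same_lettersI) auto
    obtain jvs where jvs: "gapped jvs" "list_emb (interval_emb d e) ivs jvs"
      and gap: "\<forall>x\<in>spans jvs. Suc (2 * t + s mod 2 + l) \<le> x"
      using Cons.IH[of "Suc (2 * t + s mod 2 + l)"] Cons.prems by auto
    show ?case using jvs gap same t(1)
      by (intro exI[of _ "(2 * t + s mod 2, l) # jvs"])
        (auto simp: I Suc_le_eq interval_emb_def intro!: list_emb_Cons2 exI[of _ 0])
  qed
  then obtain jvs where "gapped jvs" "list_emb (interval_emb d e) ivs jvs" by blast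
  then obtain f where "pin_embedding d e (spans ivs) (spans jvs) f"
    using pin_embedding_of_list_emb ivs(1) by blast
  then have "draws e \<sigma> (f \<circ> g)" using draws_pin_embedding[OF g] ivs(2) by simp
  with perm show ?thesis by (auto simp: pin_class_def)
qed

subsection \<open>Rigidity of long pin sequences\<close>

text \<open>
  Points \<open>4..11\<close> of the sequence of \<open>u\<close> lie above \<open>i\<close> and below \<open>j\<close>, four of them on either side.  If
  \<open>f j < f i\<close>, then no \<open>f k\<close> of these can come well after \<open>f i\<close>, as such a point is above both; but
  then \<open>f i\<close> has all of them (up to two neighbours) on one side.
\<close>

lemma pin_early_before_late:
  fixes u w :: "nat \<Rightarrow> bool" and f :: "nat \<Rightarrow> nat"
  assumes x: "\<And>i j. i < N \<Longrightarrow> j < N \<Longrightarrow> pin_x w (f i) < pin_x w (f j) \<longleftrightarrow> pin_x u i < pin_x u j"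
    and y: "\<And>i j. i < N \<Longrightarrow> j < N \<Longrightarrow> pin_y (f i) < pin_y (f j) \<longleftrightarrow> pin_y i < pin_y j"
    and u: "u 2 \<noteq> u 3" "u 4 \<noteq> u 5"
    and ij: "i < 2" "13 \<le> j" "j < N"
  shows "f i < f j"
proof (rule ccontr)
  assume "\<not> f i < f j"
  have inj: "f k \<noteq> f l" if "k < N" "l < N" "k \<noteq> l" for k l
    using x[OF that(1,2)] x[OF that(2,1)] pin_x_eq_iff[of u k l] that(3) by (metis less_irrefl linorder_neqE)
  have "f i \<noteq> f j" using inj[of i j] ij by auto
  with \<open>\<not> f i < f j\<close> have "f j < f i" by simp
  have low: "f k \<le> Suc (f i)" if "k \<in> {4..11}" for k
  proof (rule ccontr)
    assume "\<not> f k \<le> Suc (f i)"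
    then have "pin_y (f j) < pin_y (f k)" using \<open>f j < f i\<close> by (subst pin_y_less_iff) auto
    then have "pin_y j < pin_y k" using y[of j k] ij that by auto
    moreover have "pin_y k < pin_y j" using ij that by (subst pin_y_less_iff) auto
    ultimately show False by simp
  qed
  \<comment> \<open>\<open>f i\<close> is later than \<open>f k\<close> and not adjacent to it, so
    the letter at \<open>f i\<close> decides the side; in the source the letter at \<open>k\<close>
    does.\<close>
  have side: "u (k div 2) = (\<not> w (f i div 2))" if k: "k \<in> {4..11}" and "f k \<noteq> Suc (f i)" "f k \<noteq> f i - 1" for k
  proof -
    have "f k \<noteq> f i" using inj[of k i] ij k by auto
    then have less: "Suc (f k) < f i" using low[OF k] that by linarith
    have "pin_x w (f k) < pin_x w (f i) \<longleftrightarrow> w (f i div 2)"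
      using less by (subst pin_x_less_iff) auto
    moreover have "pin_x u i < pin_x u k \<longleftrightarrow> u (k div 2)"
      using ij k by (subst pin_x_less_iff) auto
    moreover have "pin_x u i \<noteq> pin_x u k" using ij k by auto
    ultimately show ?thesis using x[of k i] ij k by auto
  qed
  have four: "u (a div 2) = u (b div 2)" if "a \<in> {4..11}" "b \<in> {4..11}"
    "f a \<notin> {Suc (f i), f i - 1}" "f b \<notin> {Suc (f i), f i - 1}" for a b
    using side[of a] side[of b] that by auto
  define X where "X = {k \<in> {4..11}. f k \<in> {Suc (f i), f i - 1}}"
  have "inj_on f X"
  proof (rule inj_onI)
    fix k l assume "k \<in> X" "l \<in> X" "f k = f l"
    moreover from this have "k < N" "l < N" using ij by (auto simp: X_def)
    ultimately show "k = l" using inj by blast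
  qed
  then have "card X \<le> card {Suc (f i), f i - 1}" by (rule card_inj_on_le) (auto simp: X_def)
  also have "\<dots> \<le> 2" by (simp add: card_insert_if)
  finally have X: "card X \<le> 2" .
  have fX: "finite X" by (simp add: X_def)
  \<comment> \<open>Letters 2 and 3 belong to points 4 to 7, letters 4 and 5 to points 8 to 11; so
    each side has four points, more than the two exceptions in \<open>X\<close>.\<close>
  define A where "A = {k \<in> {4..11}. u (k div 2)}"
  define B where "B = {k \<in> {4..11}. \<not> u (k div 2)}"
  have "{4,5,6,7,8,9,10,11} = {4..11::nat}" by auto
  then have A: "A = (if u 2 then {4,5} else {6,7}) \<union> (if u 4 then {8,9} else {10,11})"
    and B: "B = (if u 2 then {6,7} else {4,5}) \<union> (if u 4 then {10,11} else {8,9})"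
    using u unfolding A_def B_def by (auto simp flip: \<open>{4,5,6,7,8,9,10,11} = {4..11::nat}\<close>)
  have "card A = 4" "card B = 4" by (auto simp: A B)
  then have "\<not> A \<subseteq> X" "\<not> B \<subseteq> X" using X card_mono[OF fX, of A] card_mono[OF fX, of B] by auto
  then obtain a b where "a \<in> A" "a \<notin> X" "b \<in> B" "b \<notin> X" by blast
  then show False using four[of a b] by (auto simp: A_def B_def X_def)
qed

text \<open>
  Once two points \<open>a < b\<close> are the preimages of the two smallest indices, the point \<open>b + k\<close>
  separates \<open>b + k - 1\<close> from \<open>a\<close>.  In the target only the successor of all indices used so far can do this.
\<close>

lemma pin_sequence_rigid:
  fixes u w :: "nat \<Rightarrow> bool" and f :: "nat \<Rightarrow> nat"
  assumes x: "\<And>i j. i < N \<Longrightarrow> j < N \<Longrightarrow> pin_x w (f i) < pin_x w (f j) \<longleftrightarrow> pin_x u i < pin_x u j"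
    and y: "\<And>i j. i < N \<Longrightarrow> j < N \<Longrightarrow> pin_y (f i) < pin_y (f j) \<longleftrightarrow> pin_y i < pin_y j"
    and u: "u 2 \<noteq> u 3" "u 4 \<noteq> u 5"
    and N: "14 \<le> N"
  shows "\<forall>i. 14 \<le> i \<and> i < N \<longrightarrow>
    f i = f 14 + (i - 14) \<and> (even (f i) \<longleftrightarrow> even i) \<and> w (f i div 2) = u (i div 2)"
proof -
  have inj: "f k \<noteq> f l" if "k < N" "l < N" "k \<noteq> l" for k l
    using x[OF that(1,2)] x[OF that(2,1)] pin_x_eq_iff[of u k l] that(3) by (metis less_irrefl linorder_neqE)
  obtain p where p: "p < N" "\<And>k. k < N \<Longrightarrow> f p \<le> f k"
    using ex_has_least_nat[of "\<lambda>k. k < N" 0 f] N by auto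
  obtain q where q: "q < N" "q \<noteq> p" "\<And>k. k < N \<Longrightarrow> k \<noteq> p \<Longrightarrow> f q \<le> f k"
  proof -
    have "(if p = 0 then 1 else 0) < N \<and> (if p = 0 then 1 else 0) \<noteq> p" using N by simp
    from ex_has_least_nat[of "\<lambda>k. k < N \<and> k \<noteq> p", OF this, of f] show ?thesis using that by blast
  qed
  define a b where "a = min p q" and "b = max p q"
  have ab: "a < b" "b < N" using p q by (auto simp: a_def b_def)
  define m where "m = f q"
  have below: "f a \<le> m" "f b \<le> m" using p q by (auto simp: a_def b_def m_def min_def max_def)
  have above: "m < f k" if "k < N" "k \<noteq> a" "k \<noteq> b" for k
  proof -
    have "k \<noteq> p" "k \<noteq> q" using that by (auto simp: a_def b_def min_def max_def split: if_splits)
    then show ?thesis using q(3)[of k] inj[of k q] that q(1) by (auto simp: m_def)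
  qed
  \<comment> \<open>Otherwise both 0 and 1 would have images before \<open>f b\<close>, while only
    \<open>a\<close> can.\<close>
  have "b \<le> 12"
  proof (rule ccontr)
    assume "\<not> b \<le> 12"
    then have "f 0 < f b" "f 1 < f b"
      using pin_early_before_late[OF x y u] ab N by auto
    moreover have "0 \<noteq> b" "1 \<noteq> b" using \<open>\<not> b \<le> 12\<close> by auto
    ultimately have "a = 0" "a = 1"
      using above[of 0] above[of 1] below(2) N by fastforce+
    then show False by simp
  qed
  have step: "f (b + k) = m + k" if "1 \<le> k" "b + k < N" for k
    using that
  proof (induction k rule: less_induct)
    case (less k)
    let ?i = "b + k"
    have lower: "m + k \<le> f ?i"
    proof -
      have "m < f ?i" using above less.prems ab by auto
      moreover have "f ?i \<noteq> m + k'" if "1 \<le> k'" "k' < k" for k'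
        using less.IH[of k'] inj[of ?i "b + k'"] that less.prems by auto
      from this[of "f ?i - m"] have "f ?i - m < 1 \<or> k \<le> f ?i - m \<or> f ?i < m" by linarith
      ultimately show ?thesis by linarith
    qed
    have prev: "f (?i - 1) \<le> m + k - 1"
      using less.IH[of "k - 1"] below less.prems by (cases "k = 1") auto
    have "f ?i \<le> m + k"
    proof (rule ccontr)
      assume "\<not> f ?i \<le> m + k"
      then have gap: "Suc (f a) < f ?i" "Suc (f (?i - 1)) < f ?i"
        using below prev less.prems by linarith+
      have lt: "?i - 1 < N" "a < N" "?i < N" "a < ?i - 1" "?i - 1 < ?i" using ab less.prems by auto
      show False
      \<comment> \<open>A target point later than \<open>f a\<close> and \<open>f (?i - 1)\<close>
        and adjacent to neither lies above both and has both on one side. In the source an even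
        point lies below its predecessor, and an odd one lies horizontally between its predecessor
        and \<open>a\<close>.\<close>
      proof (cases "even ?i")
        case True
        have "pin_y (f (?i - 1)) < pin_y (f ?i)" using gap by (subst pin_y_less_iff) auto
        then have "pin_y (?i - 1) < pin_y ?i" using y lt by blast
        then show False using True lt by (subst (asm) pin_y_less_iff) auto
      next
        case False
        have "pin_x w (f (?i - 1)) < pin_x w (f ?i) \<longleftrightarrow> pin_x w (f a) < pin_x w (f ?i)"
          using gap by (simp add: pin_x_less_iff)
        then have "pin_x u (?i - 1) < pin_x u ?i \<longleftrightarrow> pin_x u a < pin_x u ?i"
          using x lt by blast
        then show False using False lt by (simp add: pin_x_less_iff)
      qed
    qed
    with lower show ?case by simp
  qed
  have f_eq: "f i = m + (i - b)" if "13 \<le> i" "i < N" for i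
    using step[of "i - b"] that \<open>b \<le> 12\<close> by auto
  have "f i = f 14 + (i - 14) \<and> (even (f i) \<longleftrightarrow> even i) \<and> w (f i div 2) = u (i div 2)"
    if i: "14 \<le> i" "i < N" for i
  proof (intro conjI)
    show "f i = f 14 + (i - 14)" using f_eq[of i] f_eq[of 14] i \<open>b \<le> 12\<close> by auto
    \<comment> \<open>From 14 on, \<open>i - 1\<close> is still at least 13 and \<open>f_eq\<close>
      covers it. Comparing heights with this neighbour reveals parity; comparing abscissas with the
      distant \<open>a\<close> reveals the letter.\<close>
    have prev: "f i = Suc (f (i - 1))" using f_eq[of i] f_eq[of "i - 1"] i \<open>b \<le> 12\<close> by auto
    have "i - 1 < N" "i - 1 < i" "i = Suc (i - 1)" using i by auto
    then have "pin_y (f (i - 1)) < pin_y (f i) \<longleftrightarrow> odd (f i)" "pin_y (i - 1) < pin_y i \<longleftrightarrow> odd i"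
      using prev by (auto simp: pin_y_less_iff)
    then show "even (f i) \<longleftrightarrow> even i" using y[of "i - 1" i] i by auto
    have "Suc (f a) < f i" "Suc a < i" "a < N"
      using below(1) f_eq[OF _ i(2)] i ab \<open>b \<le> 12\<close> by auto
    then show "w (f i div 2) = u (i div 2)"
      using x[of a i] i by (simp add: pin_x_less_iff)
  qed
  then show ?thesis by blast
qed

subsection \<open>A family of uniformly recurrent words\<close>

definition subst :: "(bool \<Rightarrow> bool list) \<Rightarrow> bool list \<Rightarrow> bool list" where
  "subst W v = concat (map W v)"

definition coarsen :: "bool \<Rightarrow> (bool \<Rightarrow> bool list) \<Rightarrow> bool \<Rightarrow> bool list" where
  "coarsen b W x = (if b then W x else W x @ W (\<not> x))"

text \<open>
  Ten letters suffice to cover every factor that is compared below, and \<open>core W\<close> contains the images of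
  all words of ten letters.  The leading \<open>True\<close> makes each block a prefix of the next.
\<close>

definition core :: "(bool \<Rightarrow> bool list) \<Rightarrow> bool list" where
  "core W = subst W (True # concat (List.n_lists 10 [True, False]))"

text \<open>The level 0 pairs supply the unequal letters that \<open>pin_sequence_rigid\<close>
  demands. The shared prefix puts all words of at most ten coarse blocks into both blocks of the
  next level.\<close>

primrec block :: "(nat \<Rightarrow> bool) \<Rightarrow> nat \<Rightarrow> bool \<Rightarrow> bool list" where
  "block \<alpha> 0 = (\<lambda>x. [x, \<not> x])"
| "block \<alpha> (Suc k) =
    (\<lambda>x. core (coarsen (\<alpha> k) (block \<alpha> k)) @ coarsen (\<alpha> k) (block \<alpha> k) x)"

declare block.simps(2) [simp del]

abbreviation coarse :: "(nat \<Rightarrow> bool) \<Rightarrow> nat \<Rightarrow> bool \<Rightarrow> bool list" where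
  "coarse \<alpha> k \<equiv> coarsen (\<alpha> k) (block \<alpha> k)"

abbreviation block_length :: "(nat \<Rightarrow> bool) \<Rightarrow> nat \<Rightarrow> nat" where
  "block_length \<alpha> k \<equiv> length (block \<alpha> k True)"

text \<open>Blocks labelled \<open>True\<close> are nested prefixes and block \<open>n\<close> is
  longer than \<open>n\<close>, so the diagonal entry is stable.\<close>

definition limit_word :: "(nat \<Rightarrow> bool) \<Rightarrow> nat \<Rightarrow> bool" where
  "limit_word \<alpha> n = block \<alpha> n True ! n"

definition uniform :: "(bool \<Rightarrow> bool list) \<Rightarrow> nat \<Rightarrow> bool" where
  "uniform W L \<longleftrightarrow> (\<forall>x. length (W x) = L)"

section \<open>Lengths, prefixes and decompositions of blocks\<close>

lemma subst_simps [simp]: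
  "subst W [] = []" "subst W (x # v) = W x @ subst W v" "subst W (v @ v') = subst W v @ subst W v'"
  by (simp_all add: subst_def)

lemma length_subst: "uniform W L \<Longrightarrow> length (subst W v) = length v * L"
  by (induction v) (auto simp: uniform_def)

lemma nth_subst:
  assumes W: "uniform W L" and "i < length v" "j < L"
  shows "subst W v ! (i * L + j) = W (v ! i) ! j"
  using assms(2)
proof (induction v arbitrary: i)
  case (Cons x v)
  then show ?case using W \<open>j < L\<close>
    by (cases i) (auto simp: nth_append uniform_def add.assoc)
qed simp

lemma uniform_coarsen: "uniform W L \<Longrightarrow> uniform (coarsen b W) (if b then L else 2 * L)"
  by (simp add: uniform_def coarsen_def)

lemma uniform_block: "uniform (block \<alpha> k) (block_length \<alpha> k)"
proof (induction k)
  case (Suc k)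
  from uniform_coarsen[OF this] show ?case by (simp add: uniform_def block.simps(2))
qed (simp add: uniform_def)

lemma uniform_coarse:
  "uniform (coarse \<alpha> k) (if \<alpha> k then block_length \<alpha> k else 2 * block_length \<alpha> k)"
  by (rule uniform_coarsen[OF uniform_block])

lemma length_block: "length (block \<alpha> k x) = block_length \<alpha> k"
  using uniform_block by (simp add: uniform_def)

text \<open>Blocks of one level have equal length, so concatenations compare blockwise and a
  difference survives each level.\<close>

lemma block_neq: "block \<alpha> k True \<noteq> block \<alpha> k False"
proof (induction k)
  case (Suc k)
  then have "coarse \<alpha> k True \<noteq> coarse \<alpha> k False"
    using length_block[of \<alpha> k False] by (auto simp: coarsen_def append_eq_append_conv)
  then show ?case by (simp add: block.simps(2))
qed simp

lemma prefix_block_Suc: "prefix (block \<alpha> k True) (block \<alpha> (Suc k) x)"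
  by (simp add: core_def coarsen_def block.simps(2))

lemma prefix_block: "k \<le> m \<Longrightarrow> prefix (block \<alpha> k True) (block \<alpha> m True)"
proof (induction m rule: dec_induct)
  case (step m)
  then show ?case using prefix_block_Suc prefix_order.trans by blast
qed simp

lemma block_length_gt: "Suc k < block_length \<alpha> k"
proof (induction k)
  case (Suc k)
  have "coarse \<alpha> k True \<noteq> []" using Suc by (auto simp: coarsen_def)
  then have "block_length \<alpha> k < block_length \<alpha> (Suc k)"
    using Suc by (auto simp: core_def coarsen_def block.simps(2))
  with Suc show ?case by simp
qed simp

lemma prefix_nth: "prefix xs ys \<Longrightarrow> n < length xs \<Longrightarrow> ys ! n = xs ! n"
  by (auto simp: prefix_def nth_append)

lemma limit_word_eq: "n < block_length \<alpha> m \<Longrightarrow> limit_word \<alpha> n = block \<alpha> m True ! n"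
proof -
  assume n: "n < block_length \<alpha> m"
  have n': "n < block_length \<alpha> n" using block_length_gt[of n \<alpha>] by linarith
  show ?thesis
  proof (cases "n \<le> m")
    case True
    then show ?thesis unfolding limit_word_def using prefix_nth[OF prefix_block[OF True] n'] by simp
  next
    case False
    then have "m \<le> n" by simp
    then show ?thesis unfolding limit_word_def using prefix_nth[OF prefix_block[OF \<open>m \<le> n\<close>] n] by simp
  qed
qed

lemma block_cong: "(\<And>i. i < k \<Longrightarrow> \<alpha> i = \<beta> i) \<Longrightarrow> block \<alpha> k = block \<beta> k"
  by (induction k) (auto simp: block.simps(2))

lemma ex_subst_concat:
  assumes "\<And>y. y \<in> set ys \<Longrightarrow> \<exists>v. y = subst W v"
  shows "\<exists>v. concat ys = subst W v"
  using assms
proof (induction ys)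
  case Nil
  then show ?case by (intro exI[of _ "[]"]) simp
next
  case (Cons y ys)
  then obtain v v' where "y = subst W v" "concat ys = subst W v'" by (metis list.set_intros)
  then show ?case by (intro exI[of _ "v @ v'"]) simp
qed

lemma coarse_eq_subst_block: "\<exists>v. coarse \<alpha> k x = subst (block \<alpha> k) v"
  by (cases "\<alpha> k"; rule exI[of _ "if \<alpha> k then [x] else [x, \<not> x]"]) (auto simp: coarsen_def)

lemma block_Suc_eq_subst_coarse: "\<exists>v. block \<alpha> (Suc k) x = subst (coarse \<alpha> k) v"
proof -
  have "block \<alpha> (Suc k) x = core (coarse \<alpha> k) @ subst (coarse \<alpha> k) [x]"
    by (simp add: block.simps(2))
  then show ?thesis unfolding core_def subst_simps(3)[symmetric] by blast
qed

lemma block_eq_subst_block: "k \<le> m \<Longrightarrow> \<exists>v. block \<alpha> m x = subst (block \<alpha> k) v"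
proof (induction m arbitrary: x rule: dec_induct)
  case base
  then show ?case by (intro exI[of _ "[x]"]) simp
next
  case (step m)
  have "\<exists>v. coarse \<alpha> m y = subst (block \<alpha> k) v" for y
  proof -
    obtain v where "coarse \<alpha> m y = concat (map (block \<alpha> m) v)"
      using coarse_eq_subst_block subst_def by metis
    moreover have "\<exists>v'. concat (map (block \<alpha> m) v) = subst (block \<alpha> k) v'"
      using step.IH by (intro ex_subst_concat) auto
    ultimately show ?thesis by simp
  qed
  moreover obtain v where "block \<alpha> (Suc m) x = concat (map (coarse \<alpha> m) v)"
    using block_Suc_eq_subst_coarse subst_def by metis
  ultimately show ?case
    using ex_subst_concat[of "map (coarse \<alpha> m) v" "block \<alpha> k"] by auto
qed

lemma block_eq_subst_coarse: "k < m \<Longrightarrow> \<exists>v. block \<alpha> m x = subst (coarse \<alpha> k) v"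
proof -
  assume "k < m"
  then obtain v where "block \<alpha> m x = concat (map (block \<alpha> (Suc k)) v)"
    using block_eq_subst_block[of "Suc k" m] subst_def by (metis Suc_leI)
  moreover have "\<exists>v'. concat (map (block \<alpha> (Suc k)) v) = subst (coarse \<alpha> k) v'"
    by (intro ex_subst_concat) (use block_Suc_eq_subst_coarse in auto)
  ultimately show ?thesis by simp
qed

section \<open>Factors of the limit word and their recurrence\<close>

lemma limit_word_subst:
  assumes W: "uniform W L" and "\<And>m. k < m \<Longrightarrow> \<exists>v. block \<alpha> m True = subst W v"
  shows "\<exists>\<xi>. \<forall>i. \<forall>j<L. limit_word \<alpha> (i * L + j) = W (\<xi> i) ! j"
proof -
  have "\<exists>x. \<forall>j<L. limit_word \<alpha> (i * L + j) = W x ! j" for i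
  proof -
    \<comment> \<open>Large enough for block \<open>m\<close> to reach past position
      \<open>i * L + L\<close>.\<close>
    define m where "m = Suc (k + i * L + L)"
    obtain v where v: "block \<alpha> m True = subst W v" using assms(2)[of m] by (auto simp: m_def)
    have less: "i * L + L < block_length \<alpha> m" using block_length_gt[of m \<alpha>] by (simp add: m_def)
    then have "i * L + L < length v * L" using v length_subst[OF W] by simp
    then have "Suc i * L < length v * L" by simp
    then have "i < length v" by (metis Suc_lessD mult_less_cancel2)
    then show ?thesis using nth_subst[OF W] less limit_word_eq[of _ \<alpha> m] v by (metis add_less_mono1 add_strict_left_mono less_trans)
  qed
  then show ?thesis by metis
qed

lemma limit_word_block:
  "\<exists>\<xi>. \<forall>i. \<forall>j<block_length \<alpha> k.
    limit_word \<alpha> (i * block_length \<alpha> k + j) = block \<alpha> k (\<xi> i) ! j"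
proof -
  have "\<exists>v. block \<alpha> m True = subst (block \<alpha> k) v" if "k < m" for m
    using block_eq_subst_block that by (simp add: less_imp_le)
  from limit_word_subst[OF uniform_block this] show ?thesis .
qed

lemma limit_word_coarse:
  assumes "uniform (coarse \<alpha> k) L"
  shows "\<exists>\<xi>. \<forall>i. \<forall>j<L. limit_word \<alpha> (i * L + j) = coarse \<alpha> k (\<xi> i) ! j"
  by (rule limit_word_subst[OF assms block_eq_subst_coarse])

lemma nth_subst_window:
  assumes W: "uniform W L" and \<xi>: "\<forall>i. \<forall>j<L. d (i * L + j) = W (\<xi> i) ! j"
    and "q < n * L"
  shows "subst W (map \<xi> [i..<i + n]) ! q = d (i * L + q)"
proof -
  have "0 < L" using assms(3) by (cases L) auto
  define a r where "a = q div L" and "r = q mod L"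
  have q: "q = a * L + r" "r < L" "a < n"
    using assms(3) \<open>0 < L\<close> by (auto simp: a_def r_def less_mult_imp_div_less)
  have "subst W (map \<xi> [i..<i + n]) ! q = W (\<xi> (i + a)) ! r"
    using nth_subst[OF W, of a "map \<xi> [i..<i + n]" r] q by simp
  also have "\<dots> = d ((i + a) * L + r)" using \<xi> q(2) by simp
  finally show ?thesis by (simp add: q(1) algebra_simps)
qed

text \<open>Padding to exactly ten letters makes \<open>v\<close> a prefix of a word listed in
  \<open>core\<close>.\<close>

lemma sublist_subst_core:
  assumes "length v \<le> 10"
  shows "sublist (subst W v) (core W)"
proof -
  define v' where "v' = v @ replicate (10 - length v) True"
  have "length v' = 10" using assms by (simp add: v'_def)
  then have "v' \<in> set (List.n_lists 10 [True, False])" by (auto simp: set_n_lists)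
  then obtain xs ys where "List.n_lists 10 [True, False] = xs @ v' # ys" by (auto simp: in_set_conv_decomp)
  then have "core W = subst W (True # concat xs @ v) @ subst W (replicate (10 - length v) True @ concat ys)"
    by (simp add: core_def v'_def)
  then show ?thesis
    by (metis append.assoc sublist_appendI sublist_def subst_simps(3) append_Cons)
qed

text \<open>If \<open>\<alpha> k\<close> fails, an unequal pair is itself a coarse block, and an
  equal pair arises at the border between the coarse blocks of \<open>\<not> x\<close> and
  \<open>x\<close>.\<close>

lemma sublist_pair_core: "sublist (block \<alpha> k x @ block \<alpha> k y) (core (coarse \<alpha> k))"
proof -
  let ?W = "coarse \<alpha> k"
  have "sublist (block \<alpha> k x @ block \<alpha> k y)
    (subst ?W (if \<alpha> k then [x, y] else if x = y then [\<not> x, x] else [x]))"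
  proof (cases "\<alpha> k \<or> x \<noteq> y")
    case False
    then show ?thesis
      using sublist_appendI[of "block \<alpha> k x @ block \<alpha> k y" "block \<alpha> k (\<not> x)" "block \<alpha> k (\<not> x)"]
      by (simp add: coarsen_def)
  qed (cases x; cases y; auto simp: coarsen_def)
  also have "sublist \<dots> (core ?W)" by (rule sublist_subst_core) simp
  finally show ?thesis .
qed

text \<open>Every block of level \<open>Suc k\<close> starts with the core, so \<open>w\<close>
  occurs in the first aligned block starting after \<open>e\<close>, which ends within two block
  lengths.\<close>

lemma limit_word_occurrence:
  assumes "sublist w (core (coarse \<alpha> k))"
  shows "\<exists>t\<ge>e. t + length w \<le> e + 2 * block_length \<alpha> (Suc k) \<and>
    (\<forall>i<length w. limit_word \<alpha> (t + i) = w ! i)"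
proof -
  define L where "L = block_length \<alpha> (Suc k)"
  have "0 < L" using block_length_gt[of "Suc k" \<alpha>] unfolding L_def by linarith
  obtain ps ss where core: "core (coarse \<alpha> k) = ps @ w @ ss" using assms unfolding sublist_def by blast
  obtain \<xi> where \<xi>: "\<forall>i. \<forall>j<L. limit_word \<alpha> (i * L + j) = block \<alpha> (Suc k) (\<xi> i) ! j"
    using limit_word_block[of \<alpha> "Suc k", folded L_def] by (elim exE)
  have block: "block \<alpha> (Suc k) x = ps @ w @ ss @ coarse \<alpha> k x" for x
    using core by (simp add: block.simps(2))
  have len: "length ps + length w \<le> L" unfolding L_def block by simp
  define i where "i = Suc (e div L)"
  have "e = e div L * L + e mod L" "e mod L < L" using \<open>0 < L\<close> by simp_all
  then have i: "e \<le> i * L" "i * L \<le> e + L" unfolding i_def mult_Suc by linarith+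
  have "limit_word \<alpha> (i * L + length ps + j) = w ! j" if "j < length w" for j
  proof -
    have "block \<alpha> (Suc k) (\<xi> i) ! (length ps + j) = w ! j"
      unfolding block using that by (simp add: nth_append)
    moreover have "length ps + j < L" using that len by simp
    ultimately show ?thesis using \<xi> by (metis add.assoc)
  qed
  then show ?thesis using i len unfolding L_def[symmetric]
    by (intro exI[of _ "i * L + length ps"]) auto
qed

text \<open>Level \<open>M\<close> blocks are longer than \<open>M\<close>, so a factor of length
  \<open>M\<close> lies within two adjacent ones; all such pairs occur in the core.\<close>

theorem uniformly_recurrent_limit_word: "uniformly_recurrent (limit_word \<alpha>)"
  unfolding uniformly_recurrent_def
proof
  fix M
  define L where "L = block_length \<alpha> M"
  have M: "M < L" "0 < L" using block_length_gt[of M \<alpha>] unfolding L_def by linarith+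
  have W: "uniform (block \<alpha> M) L" unfolding L_def by (rule uniform_block)
  obtain \<xi> where \<xi>: "\<forall>i. \<forall>j<L. limit_word \<alpha> (i * L + j) = block \<alpha> M (\<xi> i) ! j"
    using limit_word_block[of \<alpha> M, folded L_def] by (elim exE)
  show "\<exists>R. \<forall>s e. \<exists>t\<ge>e. t + M \<le> e + R \<and> (\<forall>i<M. limit_word \<alpha> (t + i) = limit_word \<alpha> (s + i))"
  proof (rule exI[of _ "2 * block_length \<alpha> (Suc M)"], intro allI)
    fix s e
    define i r where "i = s div L" and "r = s mod L"
    have s: "s = i * L + r" "r < L" using M by (simp_all add: i_def r_def)
    define w where "w = subst (block \<alpha> M) (map \<xi> [i..<i + 2])"
    have len: "length w = 2 * L" unfolding w_def by (subst length_subst[OF W]) simp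
    have "sublist w (core (coarse \<alpha> M))"
      using sublist_pair_core[of \<alpha> M "\<xi> i" "\<xi> (Suc i)"] by (simp add: w_def)
    from limit_word_occurrence[OF this, of e] obtain t where t: "e \<le> t"
      "t + 2 * L \<le> e + 2 * block_length \<alpha> (Suc M)" "\<forall>i<2 * L. limit_word \<alpha> (t + i) = w ! i"
      by (auto simp: len)
    have "limit_word \<alpha> (t + r + j) = limit_word \<alpha> (s + j)" if "j < M" for j
      using t(3)[rule_format, of "r + j"] nth_subst_window[OF W \<xi>, of "r + j" 2 i] s that M
      by (simp add: w_def add.assoc)
    then show "\<exists>t\<ge>e. t + M \<le> e + 2 * block_length \<alpha> (Suc M) \<and>
        (\<forall>i<M. limit_word \<alpha> (t + i) = limit_word \<alpha> (s + i))"
      using t s M by (intro exI[of _ "t + r"]) auto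
  qed
qed

text \<open>With \<open>L\<close> the block length, \<open>16 * L\<close> points meet at most
  \<open>Suc (8 * L)\<close> letters, which lie within ten level \<open>k\<close> blocks. As
  \<open>\<beta> k\<close> holds, these blocks are also the coarse blocks for
  \<open>\<beta>\<close>, whose core contains every word of ten of them.\<close>

lemma pin_class_limit_word_mono:
  assumes eq: "\<And>i. i < k \<Longrightarrow> \<alpha> i = \<beta> i" and "\<beta> k"
    and \<sigma>: "\<sigma> \<in> pin_class (limit_word \<alpha>)" "length \<sigma> \<le> 16 * block_length \<alpha> k"
  shows "\<sigma> \<in> pin_class (limit_word \<beta>)"
proof (rule pin_class_mono_upto[OF _ \<sigma>])
  define L where "L = block_length \<alpha> k"
  have block_eq: "block \<alpha> k = block \<beta> k" using eq by (rule block_cong)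
  have "1 < L" using block_length_gt[of k \<alpha>] by (simp add: L_def)
  have W: "uniform (block \<alpha> k) L" unfolding L_def by (rule uniform_block)
  obtain \<xi> where \<xi>: "\<forall>i. \<forall>j<L. limit_word \<alpha> (i * L + j) = block \<alpha> k (\<xi> i) ! j"
    using limit_word_block[of \<alpha> k, folded L_def] by (elim exE)
  fix s b
  define i r where "i = s div L" and "r = s mod L"
  have s: "s = i * L + r" "r < L" using \<open>1 < L\<close> by (simp_all add: i_def r_def)
  define w where "w = subst (block \<alpha> k) (map \<xi> [i..<i + 10])"
  have len: "length w = 10 * L" unfolding w_def by (subst length_subst[OF W]) simp
  have "coarse \<beta> k = block \<alpha> k" using \<open>\<beta> k\<close> by (auto simp: coarsen_def block_eq)
  then have "sublist w (core (coarse \<beta> k))" unfolding w_def by (simp add: sublist_subst_core)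
  from limit_word_occurrence[OF this, of b] obtain t where t: "b \<le> t"
    "\<forall>i<10 * L. limit_word \<beta> (t + i) = w ! i"
    by (auto simp: len)
  have "limit_word \<beta> (t + r + j) = limit_word \<alpha> (s + j)" if "j < Suc (16 * L div 2)" for j
  proof -
    have "r + j < 10 * L" using that s(2) \<open>1 < L\<close> by simp
    then show ?thesis
      using t(2)[rule_format, of "r + j"] nth_subst_window[OF W \<xi>, of "r + j" 10 i] s
      by (simp add: w_def add.assoc)
  qed
  then show "\<exists>t\<ge>b. \<forall>i<Suc (16 * block_length \<alpha> k div 2). limit_word \<beta> (t + i) = limit_word \<alpha> (s + i)"
    unfolding L_def[symmetric] using t(1) by (intro exI[of _ "t + r"]) auto
qed

lemma block_pairs:
  "2 * m < block_length \<alpha> k \<Longrightarrow>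
    Suc (2 * m) < block_length \<alpha> k \<and> block \<alpha> k True ! (2 * m) \<noteq> block \<alpha> k True ! Suc (2 * m)"
proof -
  have W: "uniform (block \<alpha> 0) 2" by (simp add: uniform_def)
  obtain v where v: "block \<alpha> k True = subst (block \<alpha> 0) v" using block_eq_subst_block[of 0 k] by auto
  assume "2 * m < block_length \<alpha> k"
  then have m: "m < length v" using v length_subst[OF W] by simp
  then show ?thesis using nth_subst[OF W m, of 0] nth_subst[OF W m, of 1] v length_subst[OF W, of v]
    by (simp add: mult.commute)
qed

subsection \<open>Distinct enumeration sequences\<close>

text \<open>The core contains the tenth power of a level \<open>k\<close> block. \<open>u\<close> is
  the limit word read from an occurrence of it, and \<open>\<sigma>\<close> is drawn on the points
  of its first \<open>8 * L\<close> letters.\<close>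

lemma ex_periodic_perm:
  assumes "\<beta> k"
  shows "\<exists>u \<sigma> g. \<sigma> \<in> pin_class (limit_word \<beta>) \<and> length \<sigma> = 16 * block_length \<beta> k \<and>
    draws u \<sigma> g \<and> bij_betw g {..<16 * block_length \<beta> k} {..<16 * block_length \<beta> k} \<and>
    u 2 \<noteq> u 3 \<and> u 4 \<noteq> u 5 \<and>
    (\<forall>j<7 * block_length \<beta> k. u (j + block_length \<beta> k) = u j)"
proof -
  define L where "L = block_length \<beta> k"
  define W where "W = block \<beta> k"
  have "1 < L" using block_length_gt[of k \<beta>] by (simp add: L_def)
  have W: "uniform W L" unfolding W_def L_def by (rule uniform_block)
  define w where "w = subst W (replicate 10 True)"
  have len: "length w = 10 * L" unfolding w_def by (subst length_subst[OF W]) simp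
  have "coarse \<beta> k = W" using \<open>\<beta> k\<close> by (auto simp: coarsen_def W_def)
  then have "sublist w (core (coarse \<beta> k))" unfolding w_def by (simp add: sublist_subst_core)
  from limit_word_occurrence[OF this, of 0] obtain t where t: "\<forall>i<10 * L. limit_word \<beta> (t + i) = w ! i"
    by (auto simp: len)
  define u where "u i = limit_word \<beta> (t + i)" for i
  have u: "u (i * L + j) = W True ! j" if "i < 10" "j < L" for i j
  proof -
    have "i * L \<le> 9 * L" using that by (intro mult_le_mono1) simp
    then have "i * L + j < 10 * L" using that by linarith
    then show ?thesis
      using t nth_subst[OF W, of i "replicate 10 True" j] that by (simp add: u_def w_def del: replicate.simps)
  qed
  have u_mod: "u j = W True ! (j mod L)" if "j < 10 * L" for j
    using u[of "j div L" "j mod L"] that \<open>1 < L\<close> by (simp add: less_mult_imp_div_less)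
  have pairs: "u (2 * m) \<noteq> u (Suc (2 * m))" if "2 * m < 9" for m
  proof -
    \<comment> \<open>Blocks consist of pairs of letters, so reduction modulo \<open>L\<close> keeps
      pairs together.\<close>
    have "even L"
    proof (rule ccontr)
      assume "odd L"
      then have "2 * (L div 2) < L" "Suc (2 * (L div 2)) = L" by presburger+
      then show False using block_pairs[of "L div 2" \<beta> k] by (simp add: L_def)
    qed
    then have "even (2 * m mod L)" by (simp add: dvd_mod)
    then obtain n where n: "2 * m mod L = 2 * n" by blast
    have "2 * n < L" using n \<open>1 < L\<close> mod_less_divisor[of L "2 * m"] by simp
    then have p: "Suc (2 * n) < L" "W True ! (2 * n) \<noteq> W True ! Suc (2 * n)"
      using block_pairs[of n \<beta> k] by (simp_all add: L_def W_def)
    have "Suc (2 * m) mod L = Suc (2 * n)" using n p(1) by (metis mod_Suc less_irrefl)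
    then show ?thesis using u_mod[of "2 * m"] u_mod[of "Suc (2 * m)"] that \<open>1 < L\<close> n p(2) by simp
  qed
  have "\<exists>\<sigma> g. is_perm \<sigma> \<and> draws u \<sigma> g \<and> bij_betw g {..<length \<sigma>} {..<16 * L} \<and>
      length \<sigma> = card {..<16 * L}"
    by (rule exists_drawing) simp
  then obtain \<sigma> g where \<sigma>: "is_perm \<sigma>" "draws u \<sigma> g" "length \<sigma> = 16 * L" "bij_betw g {..<16 * L} {..<16 * L}"
    by auto
  have "pin_embedding u (limit_word \<beta>) (g ` {..<length \<sigma>}) UNIV (\<lambda>i. 2 * t + i)"
    by (auto simp: pin_embedding_def u_def)
  from draws_pin_embedding[OF \<sigma>(2) this] have "\<sigma> \<in> pin_class (limit_word \<beta>)"
    using \<sigma>(1) by (auto simp: pin_class_def)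
  moreover have "\<forall>j<7 * L. u (j + L) = u j" using u_mod by simp
  moreover have "u 2 \<noteq> u 3" "u 4 \<noteq> u 5" using pairs[of 1] pairs[of 2] by (simp_all add: numeral_eq_Suc)
  ultimately show ?thesis using \<sigma> unfolding L_def by blast
qed

text \<open>Rigidity copies letters 7 to \<open>8 * L - 1\<close> of \<open>u\<close> to consecutive
  letters of the limit word. This stretch contains an aligned coarse block, made of two different
  blocks that the period \<open>L\<close> would make equal.\<close>

lemma periodic_perm_notin_pin_class:
  assumes "\<not> \<alpha> k" and L: "L = block_length \<alpha> k"
    and \<sigma>: "draws u \<sigma> g" "length \<sigma> = 16 * L" "bij_betw g {..<16 * L} {..<16 * L}"
    and u: "u 2 \<noteq> u 3" "u 4 \<noteq> u 5" "\<forall>j<7 * L. u (j + L) = u j"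
  shows "\<sigma> \<notin> pin_class (limit_word \<alpha>)"
proof
  let ?w = "limit_word \<alpha>"
  assume "\<sigma> \<in> pin_class ?w"
  then obtain h where h: "draws ?w \<sigma> h" by (auto simp: pin_class_def)
  have "1 < L" using block_length_gt[of k \<alpha>] by (simp add: L)
  \<comment> \<open>\<open>f\<close> sends a point of the drawing on \<open>u\<close> to the point
    where \<open>h\<close> plots the same entry.\<close>
  define f where "f i = h (the_inv_into {..<16 * L} g i)" for i
  have inv: "the_inv_into {..<16 * L} g i < 16 * L" "g (the_inv_into {..<16 * L} g i) = i" if "i < 16 * L" for i
    using \<sigma>(3) that the_inv_into_into[of g "{..<16 * L}" i "{..<16 * L}"]
    by (auto simp: bij_betw_def f_the_inv_into_f)
  have x: "pin_x ?w (f i) < pin_x ?w (f j) \<longleftrightarrow> pin_x u i < pin_x u j" if "i < 16 * L" "j < 16 * L" for i j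
    using draws_x_less_iff[OF h, of "the_inv_into {..<16 * L} g i" "the_inv_into {..<16 * L} g j"]
      draws_x_less_iff[OF \<sigma>(1), of "the_inv_into {..<16 * L} g i" "the_inv_into {..<16 * L} g j"]
      inv that \<sigma>(2) by (simp add: f_def)
  have y: "pin_y (f i) < pin_y (f j) \<longleftrightarrow> pin_y i < pin_y j" if "i < 16 * L" "j < 16 * L" for i j
  proof -
    let ?i = "the_inv_into {..<16 * L} g i" and ?j = "the_inv_into {..<16 * L} g j"
    have "\<sigma> ! ?i < \<sigma> ! ?j \<longleftrightarrow> pin_y (h ?i) < pin_y (h ?j)" "\<sigma> ! ?i < \<sigma> ! ?j \<longleftrightarrow> pin_y (g ?i) < pin_y (g ?j)"
      using h \<sigma>(1,2) inv(1) that unfolding draws_def by auto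
    then show ?thesis using inv(2) that by (simp add: f_def)
  qed
  have "14 \<le> 16 * L" using \<open>1 < L\<close> by simp
  note rigid_all = pin_sequence_rigid[where N = "16 * L" and w = ?w and f = f and u = u, OF x y u(1,2) this]
  have rigid: "f i = f 14 + (i - 14) \<and> (even (f i) \<longleftrightarrow> even i) \<and> ?w (f i div 2) = u (i div 2)"
    if "14 \<le> i" "i < 16 * L" for i
    using rigid_all that by blast
  \<comment> \<open>Point 14 is the sideways pin of letter 7, so \<open>e\<close> is the letter
    matching letter 7 of \<open>u\<close>.\<close>
  define e where "e = f 14 div 2"
  have "even (f 14)" using rigid[of 14] \<open>1 < L\<close> by simp
  then have e: "f 14 = 2 * e" by (simp add: e_def)
  have we: "?w (e + j) = u (7 + j)" if "7 + j < 8 * L" for j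
  proof -
    have "f (14 + 2 * j) = 2 * (e + j)" "?w (f (14 + 2 * j) div 2) = u ((14 + 2 * j) div 2)"
      using rigid[of "14 + 2 * j"] that e by auto
    then show ?thesis by simp
  qed
  obtain \<xi> where \<xi>: "\<forall>i. \<forall>j<2 * L. ?w (i * (2 * L) + j) = coarse \<alpha> k (\<xi> i) ! j"
    using limit_word_coarse[of \<alpha> k "2 * L"] uniform_coarse[of \<alpha> k] assms(1) L by auto
  \<comment> \<open>The next coarse boundary is at most \<open>2 * L\<close> letters past
    \<open>e\<close>; in \<open>u\<close> that coarse block ends by letter \<open>7 + 4 * L\<close>,
    which is less than \<open>8 * L\<close>.\<close>
  define i where "i = Suc (e div (2 * L))"
  define r where "r = i * (2 * L) - e"
  have "e = e div (2 * L) * (2 * L) + e mod (2 * L)" "e mod (2 * L) < 2 * L"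
    using \<open>1 < L\<close> by (simp_all only: div_mult_mod_eq) simp
  then have r: "i * (2 * L) = e + r" "r \<le> 2 * L" unfolding r_def i_def mult_Suc by linarith+
  let ?a = "block \<alpha> k (\<xi> i)" and ?b = "block \<alpha> k (\<not> \<xi> i)"
  have ab: "coarse \<alpha> k (\<xi> i) = ?a @ ?b" using assms(1) by (simp add: coarsen_def)
  have len: "length ?a = L" "length ?b = L" using length_block[of \<alpha> k "\<xi> i"] length_block[of \<alpha> k "\<not> \<xi> i"] L by auto
  have "?a ! j = ?b ! j" if "j < L" for j
  proof -
    have "?a ! j = ?w (e + (r + j))"
      using \<xi>[rule_format, of j i] that len unfolding ab r(1) by (simp add: nth_append add.assoc)
    also have "\<dots> = u (7 + (r + j))" using that r(2) \<open>1 < L\<close> by (intro we) linarith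
    also have "\<dots> = u (7 + (r + j) + L)" using that r(2) \<open>1 < L\<close> u(3) by simp
    also have "\<dots> = ?w (e + (r + j + L))"
      using that r(2) \<open>1 < L\<close> by (subst we) (simp_all add: add.assoc)
    also have "\<dots> = ?b ! j"
      using \<xi>[rule_format, of "j + L" i] that len unfolding ab r(1) by (simp add: nth_append add.assoc)
    finally show ?thesis .
  qed
  then have "?a = ?b" using len by (simp add: nth_equalityI)
  then show False using block_neq[of \<alpha> k] by (cases "\<xi> i") auto
qed

text \<open>Up to length \<open>?n\<close> the class for \<open>\<alpha>\<close> lies inside the one
  for \<open>\<beta>\<close>; the periodic permutation makes the inclusion strict at
  \<open>?n\<close>.\<close>

lemma enumeration_seq_limit_word_neq:
  assumes eq: "\<And>i. i < k \<Longrightarrow> \<alpha> i = \<beta> i" and "\<not> \<alpha> k" "\<beta> k"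
  shows "enumeration_seq (pin_class (limit_word \<alpha>)) \<noteq> enumeration_seq (pin_class (limit_word \<beta>))"
proof -
  have L: "block_length \<beta> k = block_length \<alpha> k" using block_cong[of k \<alpha> \<beta>] eq by simp
  let ?n = "16 * block_length \<alpha> k"
  obtain u \<sigma> g where \<sigma>: "\<sigma> \<in> pin_class (limit_word \<beta>)" "length \<sigma> = ?n"
    and *: "draws u \<sigma> g" "bij_betw g {..<?n} {..<?n}" "u 2 \<noteq> u 3" "u 4 \<noteq> u 5"
      "\<forall>j<7 * block_length \<alpha> k. u (j + block_length \<alpha> k) = u j"
    using ex_periodic_perm[of \<beta> k, OF \<open>\<beta> k\<close>] unfolding L by (elim exE conjE)
  have "\<sigma> \<notin> pin_class (limit_word \<alpha>)"
    using periodic_perm_notin_pin_class[of \<alpha> k, OF \<open>\<not> \<alpha> k\<close> refl *(1) \<sigma>(2) *(2-5)] .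
  then have "{\<pi> \<in> pin_class (limit_word \<alpha>). length \<pi> = ?n} \<subset> {\<pi> \<in> pin_class (limit_word \<beta>). length \<pi> = ?n}"
    using pin_class_limit_word_mono[of k \<alpha> \<beta>, OF eq \<open>\<beta> k\<close>] \<sigma> by auto
  then have "enumeration_seq (pin_class (limit_word \<alpha>)) ?n < enumeration_seq (pin_class (limit_word \<beta>)) ?n"
    unfolding enumeration_seq_def
    by (intro psubset_card_mono finite_perm_class_length perm_class_pin_class)
  then show ?thesis by auto
qed

lemma inj_enumeration_seq_limit_word: "inj (\<lambda>\<alpha>. enumeration_seq (pin_class (limit_word \<alpha>)))"
proof (rule injI, rule ccontr)
  fix \<alpha> \<beta> :: "nat \<Rightarrow> bool"
  assume eq: "enumeration_seq (pin_class (limit_word \<alpha>)) = enumeration_seq (pin_class (limit_word \<beta>))"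
    and "\<alpha> \<noteq> \<beta>"
  then have ex: "\<exists>k. \<alpha> k \<noteq> \<beta> k" by auto
  define k where "k = (LEAST k. \<alpha> k \<noteq> \<beta> k)"
  have k: "\<alpha> k \<noteq> \<beta> k" unfolding k_def using ex by (rule LeastI_ex)
  have below: "\<alpha> i = \<beta> i" if "i < k" for i using not_less_Least that unfolding k_def by blast
  show False
    using enumeration_seq_limit_word_neq[of k \<alpha> \<beta>] enumeration_seq_limit_word_neq[of k \<beta> \<alpha>] below k eq
    by (cases "\<alpha> k") auto
qed

section \<open>Cantor's diagonal argument and the conclusion\<close>

lemma uncountable_UNIV_nat_bool: "uncountable (UNIV :: (nat \<Rightarrow> bool) set)"
proof
  assume "countable (UNIV :: (nat \<Rightarrow> bool) set)"
  then have "range (from_nat_into (UNIV :: (nat \<Rightarrow> bool) set)) = UNIV"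
    by (intro range_from_nat_into) auto
  then obtain n where "from_nat_into UNIV n = (\<lambda>n. \<not> from_nat_into (UNIV :: (nat \<Rightarrow> bool) set) n n)"
    by (metis rangeE UNIV_I)
  then show False by (metis (full_types))
qed

theorem theorem1p1:
  shows "uncountable {enumeration_seq C | C. perm_class C \<and> wqo_class C}"
proof
  assume "countable {enumeration_seq C | C. perm_class C \<and> wqo_class C}"
  moreover have "range (\<lambda>\<alpha>. enumeration_seq (pin_class (limit_word \<alpha>))) \<subseteq>
      {enumeration_seq C | C. perm_class C \<and> wqo_class C}"
    using perm_class_pin_class wqo_pin_class[OF uniformly_recurrent_limit_word] by blast
  ultimately have "countable (range (\<lambda>\<alpha>. enumeration_seq (pin_class (limit_word \<alpha>))))"
    by (rule countable_subset[rotated])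
  then have "countable (UNIV :: (nat \<Rightarrow> bool) set)"
    using inj_enumeration_seq_limit_word by (rule countable_image_inj_on)
  then show False using uncountable_UNIV_nat_bool by contradiction
qed

end
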